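(* Let $r\in[1,\infty)$, let $\gamma(p)=\bigl(\sum_{\ell=1}^L[\gamma_\ell(p)]^r\bigr)^{1/r}$ with $\gamma_\ell(p)=[p\cdot G_\ell\,p]^{1/2}$, $G_\ell\in\mathbb{R}^{d\times d}$ symmetric positive definite, and let $u_D\in\mathbb{R}$. Let $n\ge1$ and let $(\Phi^n,W^n)\in K^h\times S^h_D$ be a solution of the obstacle scheme (defined in the context) for given $(\Phi^{n-1},W^{n-1})$. Then $$\mathcal{E}^h_\gamma(W^n,\Phi^n)-u_D\,\lambda\,(\widehat\varrho(\Phi^{n-1},\Phi^n),\Phi^n-\Phi^{n-1})^h+\tau_n\,(\pi^h[b(\Phi^{n-1})]\,\nabla W^n,\nabla W^n)+\tau_n\,\frac{\lambda\rho}{a}\,\frac{\epsilon}{c_\Psi}\left|[\mu(\nabla\Phi^{n-1})]^{1/2}\,\frac{\Phi^n-\Phi^{n-1}}{\tau_n}\right|_h^2\le\mathcal{E}^h_\gamma(W^{n-1},\Phi^{n-1}).$$ In particular, if the splitting $\varrho=\varrho^++\varrho^-$ satisfies $u_D(\varrho^+)'(s)\le0$ and $-u_D(\varrho^-)'(s)\le0$ for all $s\in[-1,1]$, then $$\mathcal{F}^h_\gamma(W^n,\Phi^n)+\tau_n\,(\pi^h[b(\Phi^{n-1})]\,\nabla W^n,\nabla W^n)+\tau_n\,\frac{\lambda\rho}{a}\,\frac{\epsilon}{c_\Psi}\left|[\mu(\nabla\Phi^{n-1})]^{1/2}\,\frac{\Phi^n-\Phi^{n-1}}{\tau_n}\r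ight|_h^2\le\mathcal{F}^h_\gamma(W^{n-1},\Phi^{n-1}).$$
   Context: Domain and boundary. $\Omega\subset\mathbb{R}^d$, $d\in\{2,3\}$, is a polyhedral domain, $\partial\Omega=\overline{\partial_N\Omega}\cup\overline{\partial_D\Omega}$ with $\partial_N\Omega\cap\partial_D\Omega=\emptyset$, and one of: (i) $\partial\Omega=\partial_D\Omega$; (ii) $\partial\Omega=\partial_N\Omega$; (iii) $\Omega=(-H,H)^d$, $\partial_D\Omega=[-H,H]^{d-1}\times\{H\}$, $H>0$. In case (ii) one sets $u_D:=0$. Parameters (constants): $\epsilon>0$, $\vartheta\ge0$, $\lambda>0$, $\rho\ge0$, $\alpha>0$, $a>0$, $\mathcal{K}_\pm>0$; $b(s)=\frac12(1+s)\mathcal{K}_++\frac12(1-s)\mathcal{K}_-$. Coefficient functions. $\beta:\mathbb{R}^d\to\mathbb{R}_{\ge0}$ is positively homogeneous of degree one with $\beta(p)>0$ for $p\ne0$; $\mu(p)=\gamma(p)/\beta(p)$ for $p\neq0$ and $\mu(0)=\bar\mu$, a constant with $\min_{p\ne0}\gamma(p)/\beta(p)\le\bar\mu\le\max_{p\neq0}\gamma(p)/\beta(p)$. The shape function $\varrho\in C^1(\mathbb{R})$ satisfies $\varrho\ge0$ on $[-1,1]$, $\int_{-1}^1\varrho=1$, and $\mathrm{P}(s):=\int_{-1}^s\varrho(y)\,dy$. A splitting $\varrho=\varrho^++\varrho^-$ with $\varrho^\pm\in C^1(\mathbb{R})$ is fixed and $\widehat\varrho(s_0,s_1):=\varrho^+(s_1)+\varrho^-(s_0)$.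 Potential. $\Psi(s)=\frac12(1-s^2)$ for $|s|\le1$, $\Psi(s)=\infty$ for $|s|>1$ (obstacle potential), $c_\Psi=\int_{-1}^1\sqrt{2\Psi(s)}\,ds=\pi/2$. Anisotropy matrices. With the convention $\gamma_\ell(0)/\gamma(0):=1$, for all $p\in\mathbb{R}^d$: $B_r(q,p):=\gamma(q)\sum_{\ell=1}^L\bigl[\frac{\gamma_\ell(p)}{\gamma(p)}\bigr]^{r-1}[\gamma_\ell(q)]^{-1}G_\ell$ if $q\ne0$, and $B_r(0,p):=L^{1/r}\sum_{\ell=1}^L\bigl[\frac{\gamma_\ell(p)}{\gamma(p)}\bigr]^{r-1}G_\ell$. Finite elements. $\mathcal{T}^h$ is a partitioning of $\Omega$ into disjoint open simplices; $S^h\subset H^1(\Omega)$ is the space of continuous functions on $\overline\Omega$ that are affine on each simplex, with nodes $\{p_j\}_{j\in J}$ and nodal interpolation $\pi^h:C(\overline\Omega)\to S^h$. $(\cdot,\cdot)$ and $|\cdot|_0$ are the $L^2(\Omega)$ inner product and norm. For piecewise continuous functions, $(\eta_1,\eta_2)^h:=\sum_{\sigma\in\mathcal{T}^h}\frac{|\sigma|}{d+1}\sum_{k=0}^d(\eta_1\eta_2)((p_{j_k})^-)$, where $p_{j_0},\dots,p_{j_d}$ are the vertices of $\sigma$ and $\eta((p_{j_k})^-)$ is the limit from within $\sigma$; $|\eta|_h:=[(\eta,\eta)^h]^{1/2}$. $K^h:=\{\chi\in S^h:|\chi|\le1\text{ in }\Omega\}$, $S^h_0:=\{\chi\in S^h:\chi=0\text{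 on }\partial_D\Omega\}$, $S^h_D:=\{\chi\in S^h:\chi=u_D\text{ on }\partial_D\Omega\}$ (for $u_D\in\mathbb{R}$). $\tau_n>0$ is the $n$-th time step. Obstacle scheme (step $n\ge1$). Given $\Phi^{n-1}\in K^h$ and $W^{n-1}\in S^h_D$ (the latter enters only multiplied by $\vartheta$, so it is irrelevant if $\vartheta=0$), find $(\Phi^n,W^n)\in K^h\times S^h_D$ such that $$\vartheta\Bigl(\tfrac{W^n-W^{n-1}}{\tau_n},\chi\Bigr)^h+\lambda\Bigl(\widehat\varrho(\Phi^{n-1},\Phi^n)\tfrac{\Phi^n-\Phi^{n-1}}{\tau_n},\chi\Bigr)^h+(\pi^h[b(\Phi^{n-1})]\nabla W^n,\nabla\chi)=0\quad\forall\chi\in S^h_0,$$ $$\epsilon\tfrac\rho\alpha\Bigl(\mu(\nabla\Phi^{n-1})\tfrac{\Phi^n-\Phi^{n-1}}{\tau_n},\chi-\Phi^n\Bigr)^h+\epsilon\,(B_r(\nabla\Phi^{n-1},\nabla\Phi^n)\nabla\Phi^n,\nabla[\chi-\Phi^n])\ge\Bigl(c_\Psi\tfrac a\alpha\,\widehat\varrho(\Phi^{n-1},\Phi^n)W^n+\epsilon^{-1}\Phi^{n-1},\chi-\Phi^n\Bigr)^h\quad\forall\chi\in K^h.$$ Discrete energies. $\mathcal{E}^h_\gamma(W,\Phi)=\frac\vartheta2|W-u_D|_h^2+\frac{\lambda\alpha}{a}\frac1{c_\Psi}\bigl[\frac12\epsilon|\gamma(\nabla\Phi)|_0^2+\epsilon^{-1}(\Psi(\Phi),1)^h\bigr]$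 and $\mathcal{F}^h_\gamma(W,\Phi)=\mathcal{E}^h_\gamma(W,\Phi)-\lambda u_D(\mathrm{P}(\Phi),1)^h$. *)

theory Defs
  imports "HOL-Analysis.Analysis"
begin

section \<open>Domain and mesh\<close>

definition polyhedral_domain :: "(real^'d) set \<Rightarrow> bool" where
  "polyhedral_domain \<Omega> \<longleftrightarrow>
     \<Omega> \<noteq> {} \<and> open \<Omega> \<and> connected \<Omega> \<and> bounded \<Omega> \<and>
     (\<exists>\<F>. finite \<F> \<and> (\<forall>F\<in>\<F>. polytope F \<and> aff_dim F = int CARD('d) - 1) \<and> frontier \<Omega> = \<Union>\<F>)"

text \<open>The elements are open simplices. The last conjunct (two closed elements meet in a common
  face) is the usual conformity of the mesh; without it there is no nodal interpolation operator
  from the continuous functions into the finite element space.\<close>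

definition simplicial_partition :: "(real^'d) set set \<Rightarrow> (real^'d) set \<Rightarrow> bool" where
  "simplicial_partition \<T> \<Omega> \<longleftrightarrow>
     finite \<T> \<and>
     (\<forall>\<sigma>\<in>\<T>. \<sigma> \<subseteq> \<Omega> \<and> (\<exists>S. int CARD('d) simplex S \<and> \<sigma> = interior S)) \<and>
     pairwise disjnt \<T> \<and>
     closure \<Omega> = (\<Union>\<sigma>\<in>\<T>. closure \<sigma>) \<and>
     triangulation (closure ` \<T>)"

definition vertices :: "(real^'d) set \<Rightarrow> (real^'d) set" where
  "vertices \<sigma> = {p. p extreme_point_of (closure \<sigma>)}"

definition nodes :: "(real^'d) set set \<Rightarrow> (real^'d) set" where
  "nodes \<T> = (\<Union>\<sigma>\<in>\<T>. vertices \<sigma>)"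

section \<open>Finite element spaces\<close>

text \<open>Functions on the closure of \<open>\<Omega>\<close> are represented by total functions whose values elsewhere
  are irrelevant.\<close>

definition Sh :: "(real^'d) set \<Rightarrow> (real^'d) set set \<Rightarrow> (real^'d \<Rightarrow> real) set" where
  "Sh \<Omega> \<T> = {\<eta>. continuous_on (closure \<Omega>) \<eta> \<and>
                 (\<forall>\<sigma>\<in>\<T>. \<exists>v c. \<forall>x\<in>\<sigma>. \<eta> x = v \<bullet> x + c)}"

definition Kh :: "(real^'d) set \<Rightarrow> (real^'d) set set \<Rightarrow> (real^'d \<Rightarrow> real) set" where
  "Kh \<Omega> \<T> = {\<eta> \<in> Sh \<Omega> \<T>. \<forall>x\<in>\<Omega>. \<bar>\<eta> x\<bar> \<le> 1}"

text \<open>The elements of \<open>Sh\<close> with the constant value \<open>c\<close> on the Dirichlet boundary \<open>dD\<close>: this is the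
  test space for \<open>c = 0\<close> and the trial space for \<open>c = u_D\<close>.\<close>

definition Sh_bc ::
  "(real^'d) set \<Rightarrow> (real^'d) set set \<Rightarrow> (real^'d) set \<Rightarrow> real \<Rightarrow> (real^'d \<Rightarrow> real) set" where
  "Sh_bc \<Omega> \<T> dD c = {\<eta> \<in> Sh \<Omega> \<T>. \<forall>x\<in>dD. \<eta> x = c}"

text \<open>The interpolant is unique on the closure of \<open>\<Omega>\<close> only, hence \<open>SOME\<close>.\<close>

definition nodal_interp ::
  "(real^'d) set \<Rightarrow> (real^'d) set set \<Rightarrow> (real^'d \<Rightarrow> real) \<Rightarrow> real^'d \<Rightarrow> real" where
  "nodal_interp \<Omega> \<T> f = (SOME \<eta>. \<eta> \<in> Sh \<Omega> \<T> \<and> (\<forall>p\<in>nodes \<T>. \<eta> p = f p))"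

text \<open>For \<open>f\<close> in \<open>Sh\<close> the gradient exists inside every element; its unspecified values on the
  mesh skeleton, a null set, affect neither of the inner products below.\<close>

definition grad :: "(real^'d \<Rightarrow> real) \<Rightarrow> real^'d \<Rightarrow> real^'d" where
  "grad f x = (THE D. GDERIV f x :> D)"

section \<open>Inner products\<close>

definition L2_inner ::
  "(real^'d) set \<Rightarrow> (real^'d \<Rightarrow> 'b::real_inner) \<Rightarrow> (real^'d \<Rightarrow> 'b) \<Rightarrow> real" where
  "L2_inner \<Omega> f g = (LINT x:\<Omega>|lebesgue. f x \<bullet> g x)"

definition L2_nrm :: "(real^'d) set \<Rightarrow> (real^'d \<Rightarrow> 'b::real_inner) \<Rightarrow> real" where
  "L2_nrm \<Omega> f = sqrt (L2_inner \<Omega> f f)"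

definition lumped ::
  "(real^'d) set set \<Rightarrow> (real^'d \<Rightarrow> real) \<Rightarrow> (real^'d \<Rightarrow> real) \<Rightarrow> real" where
  "lumped \<T> f g =
     (\<Sum>\<sigma>\<in>\<T>. measure lebesgue \<sigma> / (real CARD('d) + 1) *
        (\<Sum>p\<in>vertices \<sigma>. Lim (at p within \<sigma>) (\<lambda>x. f x * g x)))"

text \<open>The same quadrature for functions that may take the value \<open>\<infinity>\<close>, as the obstacle potential.\<close>

definition lumped_ereal ::
  "(real^'d) set set \<Rightarrow> (real^'d \<Rightarrow> ereal) \<Rightarrow> (real^'d \<Rightarrow> ereal) \<Rightarrow> ereal" where
  "lumped_ereal \<T> f g =
     (\<Sum>\<sigma>\<in>\<T>. ereal (measure lebesgue \<sigma> / (real CARD('d) + 1)) *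
        (\<Sum>p\<in>vertices \<sigma>. Lim (at p within \<sigma>) (\<lambda>x. f x * g x)))"

definition lumped_nrm :: "(real^'d) set set \<Rightarrow> (real^'d \<Rightarrow> real) \<Rightarrow> real" where
  "lumped_nrm \<T> f = sqrt (lumped \<T> f f)"

section \<open>Anisotropy\<close>

definition sym_pos_def :: "real^'d^'d \<Rightarrow> bool" where
  "sym_pos_def A \<longleftrightarrow> transpose A = A \<and> (\<forall>p. p \<noteq> 0 \<longrightarrow> p \<bullet> (A *v p) > 0)"

definition gam_l :: "(nat \<Rightarrow> real^'d^'d) \<Rightarrow> nat \<Rightarrow> real^'d \<Rightarrow> real" where
  "gam_l G l p = sqrt (p \<bullet> (G l *v p))"

definition gam :: "real \<Rightarrow> nat \<Rightarrow> (nat \<Rightarrow> real^'d^'d) \<Rightarrow> real^'d \<Rightarrow> real" where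
  "gam r L G p = (\<Sum>l=1..L. gam_l G l p powr r) powr (1 / r)"

text \<open>The quotient \<open>\<gamma>\<^sub>l / \<gamma>\<close> with the convention that its value at the origin is 1.\<close>

definition gam_ratio :: "real \<Rightarrow> nat \<Rightarrow> (nat \<Rightarrow> real^'d^'d) \<Rightarrow> nat \<Rightarrow> real^'d \<Rightarrow> real" where
  "gam_ratio r L G l p = (if p = 0 then 1 else gam_l G l p / gam r L G p)"

definition Br ::
  "real \<Rightarrow> nat \<Rightarrow> (nat \<Rightarrow> real^'d^'d) \<Rightarrow> real^'d \<Rightarrow> real^'d \<Rightarrow> real^'d^'d" where
  "Br r L G q p =
     (if q \<noteq> 0
      then gam r L G q *\<^sub>R
             (\<Sum>l=1..L. (gam_ratio r L G l p powr (r - 1) * inverse (gam_l G l q)) *\<^sub>R G l)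
      else (real L powr (1 / r)) *\<^sub>R (\<Sum>l=1..L. (gam_ratio r L G l p powr (r - 1)) *\<^sub>R G l))"

definition mu_fun :: "(real^'d \<Rightarrow> real) \<Rightarrow> (real^'d \<Rightarrow> real) \<Rightarrow> real \<Rightarrow> real^'d \<Rightarrow> real" where
  "mu_fun \<gamma> \<beta> mubar p = (if p = 0 then mubar else \<gamma> p / \<beta> p)"

section \<open>Potential, shape function and conductivity\<close>

definition obstacle_pot :: "real \<Rightarrow> ereal" where
  "obstacle_pot s = (if \<bar>s\<bar> \<le> 1 then ereal (1/2 * (1 - s\<^sup>2)) else \<infinity>)"

text \<open>The value is \<open>\<pi> / 2\<close>; the potential is finite on the range of integration.\<close>

definition c_Psi :: real where
  "c_Psi = (LBINT s=-1..1. sqrt (2 * real_of_ereal (obstacle_pot s)))"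

definition Pfun :: "(real \<Rightarrow> real) \<Rightarrow> real \<Rightarrow> real" where
  "Pfun \<rho>s s = (LBINT y=-1..s. \<rho>s y)"

definition rho_hat :: "(real \<Rightarrow> real) \<Rightarrow> (real \<Rightarrow> real) \<Rightarrow> real \<Rightarrow> real \<Rightarrow> real" where
  "rho_hat \<rho>p \<rho>m s0 s1 = \<rho>p s1 + \<rho>m s0"

definition b_fun :: "real \<Rightarrow> real \<Rightarrow> real \<Rightarrow> real" where
  "b_fun Kp Km s = 1/2 * (1 + s) * Kp + 1/2 * (1 - s) * Km"

section \<open>Discrete energies\<close>

definition Eh ::
  "(real^'d) set \<Rightarrow> (real^'d) set set \<Rightarrow> real \<Rightarrow> real \<Rightarrow> real \<Rightarrow> real \<Rightarrow> real \<Rightarrow> real \<Rightarrow>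
   (real^'d \<Rightarrow> real) \<Rightarrow> (real^'d \<Rightarrow> real) \<Rightarrow> (real^'d \<Rightarrow> real) \<Rightarrow> ereal" where
  "Eh \<Omega> \<T> \<epsilon> \<theta> lam \<alpha> a uD \<gamma> W \<Phi> =
     ereal (\<theta> / 2 * (lumped_nrm \<T> (\<lambda>x. W x - uD))\<^sup>2) +
     ereal (lam * \<alpha> / a * (1 / c_Psi)) *
       (ereal (1/2 * \<epsilon> * (L2_nrm \<Omega> (\<lambda>x. \<gamma> (grad \<Phi> x)))\<^sup>2) +
        ereal (inverse \<epsilon>) * lumped_ereal \<T> (\<lambda>x. obstacle_pot (\<Phi> x)) (\<lambda>x. 1))"

definition Fh ::
  "(real^'d) set \<Rightarrow> (real^'d) set set \<Rightarrow> real \<Rightarrow> real \<Rightarrow> real \<Rightarrow> real \<Rightarrow> real \<Rightarrow> real \<Rightarrow>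
   (real \<Rightarrow> real) \<Rightarrow>
   (real^'d \<Rightarrow> real) \<Rightarrow> (real^'d \<Rightarrow> real) \<Rightarrow> (real^'d \<Rightarrow> real) \<Rightarrow> ereal" where
  "Fh \<Omega> \<T> \<epsilon> \<theta> lam \<alpha> a uD \<rho>s \<gamma> W \<Phi> =
     Eh \<Omega> \<T> \<epsilon> \<theta> lam \<alpha> a uD \<gamma> W \<Phi> - ereal (lam * uD * lumped \<T> (\<lambda>x. Pfun \<rho>s (\<Phi> x)) (\<lambda>x. 1))"

section \<open>The obstacle scheme\<close>

text \<open>One time step of length \<open>\<tau>\<close> from \<open>(\<Phi>0, W0)\<close> to \<open>(\<Phi>1, W1)\<close>.\<close>

definition obstacle_step ::
  "(real^'d) set \<Rightarrow> (real^'d) set set \<Rightarrow> (real^'d) set \<Rightarrow>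
   real \<Rightarrow> real \<Rightarrow> real \<Rightarrow> real \<Rightarrow> real \<Rightarrow> real \<Rightarrow> real \<Rightarrow>
   (real \<Rightarrow> real) \<Rightarrow> (real \<Rightarrow> real \<Rightarrow> real) \<Rightarrow> (real^'d \<Rightarrow> real) \<Rightarrow> (real^'d \<Rightarrow> real^'d \<Rightarrow> real^'d^'d) \<Rightarrow>
   real \<Rightarrow> (real^'d \<Rightarrow> real) \<Rightarrow> (real^'d \<Rightarrow> real) \<Rightarrow> (real^'d \<Rightarrow> real) \<Rightarrow> (real^'d \<Rightarrow> real) \<Rightarrow> bool" where
  "obstacle_step \<Omega> \<T> dD \<epsilon> \<theta> lam \<rho> \<alpha> a uD b \<rho>h \<mu> B \<tau> \<Phi>0 W0 \<Phi>1 W1 \<longleftrightarrow>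
     \<Phi>1 \<in> Kh \<Omega> \<T> \<and> W1 \<in> Sh_bc \<Omega> \<T> dD uD \<and>
     (\<forall>\<eta>\<in>Sh_bc \<Omega> \<T> dD 0.
        \<theta> * lumped \<T> (\<lambda>x. (W1 x - W0 x) / \<tau>) \<eta>
        + lam * lumped \<T> (\<lambda>x. \<rho>h (\<Phi>0 x) (\<Phi>1 x) * ((\<Phi>1 x - \<Phi>0 x) / \<tau>)) \<eta>
        + L2_inner \<Omega> (\<lambda>x. nodal_interp \<Omega> \<T> (\<lambda>y. b (\<Phi>0 y)) x *\<^sub>R grad W1 x) (grad \<eta>) = 0) \<and>
     (\<forall>\<eta>\<in>Kh \<Omega> \<T>.
        \<epsilon> * (\<rho> / \<alpha>) * lumped \<T> (\<lambda>x. \<mu> (grad \<Phi>0 x) * ((\<Phi>1 x - \<Phi>0 x) / \<tau>)) (\<lambda>x. \<eta> x - \<Phi>1 x)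
        + \<epsilon> * L2_inner \<Omega> (\<lambda>x. B (grad \<Phi>0 x) (grad \<Phi>1 x) *v grad \<Phi>1 x) (grad (\<lambda>x. \<eta> x - \<Phi>1 x))
        \<ge> lumped \<T> (\<lambda>x. c_Psi * (a / \<alpha>) * \<rho>h (\<Phi>0 x) (\<Phi>1 x) * W1 x + inverse \<epsilon> * \<Phi>0 x)
            (\<lambda>x. \<eta> x - \<Phi>1 x))"

end

theory Submission
  imports Defs
begin

text \<open>The estimate is obtained by testing. The heat equation is tested with \<open>W n - uD\<close>, which
  vanishes on the Dirichlet boundary, and the variational inequality with \<open>\<Phi> (n - 1)\<close>, which lies
  in the convex set \<open>Kh\<close>. After scaling the inequality by \<open>lam * \<alpha> / (a * c_Psi)\<close>, the two terms
  that couple \<open>W n\<close> with the increment of \<open>\<Phi>\<close> cancel, up to the contribution of \<open>uD\<close>.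

  What remains is compared with the increment of the energy term by term. The temperature part and
  the obstacle potential only need \<open>2 * x * (x - y) \<ge> x\<^sup>2 - y\<^sup>2\<close> and
  \<open>- 2 * y * (x - y) \<ge> y\<^sup>2 - x\<^sup>2\<close>; the latter is the concavity of the potential, which makes its
  explicit discretisation stable. The gradient part rests on
  \<open>Br q p p \<bullet> (p - q) \<ge> (\<gamma> p)\<^sup>2 / 2 - (\<gamma> q)\<^sup>2 / 2\<close> (lemma \<open>Br_energy_increment\<close>): the
  Cauchy--Schwarz inequality for each \<open>G l\<close> gives \<open>Br q p p \<bullet> q \<le> \<gamma> p * \<gamma> q\<close>, and Hoelder's inequality
  gives \<open>Br q p p \<bullet> p \<ge> (\<gamma> p)\<^sup>2\<close>.

  For the second assertion it suffices that \<open>uD * rho_hat s t * (t - s)\<close> is at most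
  \<open>uD * (Pfun t - Pfun s)\<close> at every vertex (lemma \<open>rho_hat_increment\<close>), which follows from the mean
  value theorem and the monotonicity of the two parts of the splitting.

  All these comparisons are pointwise, at the vertices or on the elements: the quadrature is a
  nonnegative combination of vertex limits (\<open>vertex_sum\<close>), and the gradients are constant on the
  elements, whose union has full measure (lemma \<open>L2_inner_elementwise_constant\<close>). The term with the
  interpolated conductivity is carried along and never evaluated.\<close>

section \<open>The anisotropy\<close>

lemma sym_pos_def_sym:
  assumes "sym_pos_def A"
  shows "x \<bullet> (A *v y) = y \<bullet> (A *v x)"
proof -
  have "transpose A = A"
    using assms by (simp add: sym_pos_def_def)
  then show ?thesis
    by (metis dot_lmul_matrix inner_commute transpose_matrix_vector)
qed

lemma gam_l_pos:
  assumes "sym_pos_def (G l)" "p \<noteq> 0"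
  shows "gam_l G l p > 0"
  using assms by (simp add: gam_l_def sym_pos_def_def)

lemma gam_l_0 [simp]: "gam_l G l 0 = 0"
  by (simp add: gam_l_def)

lemma gam_0 [simp]: "gam r L G 0 = 0"
  by (simp add: gam_def)

lemma gam_nonneg: "gam r L G p \<ge> 0"
  by (simp add: gam_def)

lemma gam_l_power2:
  assumes "sym_pos_def (G l)"
  shows "(gam_l G l p)\<^sup>2 = p \<bullet> (G l *v p)"
  using assms by (cases "p = 0") (auto simp: gam_l_def sym_pos_def_def less_imp_le)

text \<open>The Cauchy--Schwarz inequality in the inner product defined by \<open>G l\<close>.\<close>

lemma gam_l_Cauchy_Schwarz:
  assumes G: "sym_pos_def (G l)"
  shows "q \<bullet> (G l *v p) \<le> gam_l G l p * gam_l G l q"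
proof (cases "p = 0 \<or> q = 0")
  case True
  then show ?thesis by auto
next
  case False
  define s t where "s = gam_l G l p" and "t = gam_l G l q"
  have pos: "s > 0" "t > 0"
    using False gam_l_pos[of G l] G by (auto simp: s_def t_def)
  have "0 \<le> (gam_l G l (t *\<^sub>R p - s *\<^sub>R q))\<^sup>2"
    by simp
  also have "\<dots> = t * t * s\<^sup>2 + s * s * t\<^sup>2 - 2 * s * t * (q \<bullet> (G l *v p))"
    unfolding s_def t_def gam_l_power2[of G l, OF G]
    by (simp add: matrix_vector_mult_diff_distrib matrix_vector_mult_scaleR inner_diff_left
        inner_diff_right sym_pos_def_sym[OF G, of p q] algebra_simps)
  finally have "2 * (s * t) * (q \<bullet> (G l *v p)) \<le> 2 * (s * t) * (s * t)"
    by (simp add: power2_eq_square algebra_simps)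
  then show ?thesis
    using pos unfolding s_def[symmetric] t_def[symmetric] by simp
qed

lemma gam_powr:
  assumes "r \<ge> 1"
  shows "gam r L G p powr r = (\<Sum>l=1..L. gam_l G l p powr r)"
proof -
  have "(\<Sum>l=1..L. gam_l G l p powr r) \<ge> 0"
    by (simp add: sum_nonneg)
  then show ?thesis
    using assms by (simp add: gam_def powr_powr)
qed

lemma gam_pos:
  assumes "L \<ge> 1" "\<And>l. l \<in> {1..L} \<Longrightarrow> sym_pos_def (G l)" "p \<noteq> 0"
  shows "gam r L G p > 0"
proof -
  have "gam_l G l p > 0" if "l \<in> {1..L}" for l
    using assms(2)[OF that] assms(3) by (rule gam_l_pos)
  then have "(\<Sum>l=1..L. gam_l G l p powr r) > 0"
    using assms(1) by (intro sum_pos) (auto simp: less_le)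
  then show ?thesis by (simp add: gam_def)
qed

text \<open>A pointwise form of Hoelder's inequality: with \<open>t = y / x\<close> it is the inequality
  \<open>r / t + t powr r \<ge> r + 1\<close>, an instance of the weighted inequality between the arithmetic and
  the geometric mean.\<close>

lemma powr_tangent_inequality:
  fixes x y r :: real
  assumes "r \<ge> 1" "x > 0" "y > 0"
  shows "x powr (r + 1) / y \<ge> x powr r + (x powr r - y powr r) / r"
proof -
  define u where "u = ln (y / x)"
  have y: "y = x * exp u"
    using assms by (simp add: u_def)
  have "r * (1 - u) + (1 + r * u) \<le> r * exp (- u) + exp (r * u)"
    using assms exp_ge_add_one_self[of "- u"] exp_ge_add_one_self[of "r * u"]
    by (intro add_mono mult_left_mono) auto
  then have "1 + (1 - exp (r * u)) / r \<le> exp (- u)"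
    using assms by (simp add: field_simps)
  then have "x powr r * (1 + (1 - exp (r * u)) / r) \<le> x powr r * exp (- u)"
    using assms by (intro mult_left_mono) auto
  moreover have "y powr r = x powr r * exp (r * u)"
    using assms by (simp add: y powr_mult powr_def[of "exp u"])
  moreover have "x powr (r + 1) / y = x powr r * exp (- u)"
    using assms by (simp add: y powr_add exp_minus field_simps)
  ultimately show ?thesis by (simp add: field_simps)
qed

lemma sum_powr_tangent:
  fixes x y :: "'i \<Rightarrow> real"
  assumes "r \<ge> 1" "\<And>l. l \<in> I \<Longrightarrow> x l > 0" "\<And>l. l \<in> I \<Longrightarrow> y l > 0"
    and "(\<Sum>l\<in>I. x l powr r) = 1" "(\<Sum>l\<in>I. y l powr r) = 1"
  shows "(\<Sum>l\<in>I. x l powr (r + 1) / y l) \<ge> 1"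
proof -
  have "(\<Sum>l\<in>I. x l powr r + (x l powr r - y l powr r) / r) \<le> (\<Sum>l\<in>I. x l powr (r + 1) / y l)"
    using assms by (intro sum_mono powr_tangent_inequality) auto
  then show ?thesis
    using assms by (simp add: sum.distrib sum_subtractf sum_divide_distrib[symmetric])
qed

lemma matrix_vector_mult_sum_left:
  "(\<Sum>l\<in>I. A l) *v x = (\<Sum>l\<in>I. A l *v (x::real^'n))"
  by (induction I rule: infinite_finite_induct) (auto simp: matrix_vector_mult_add_rdistrib)

text \<open>The weights \<open>y l\<close> normalise the linearisation point: \<open>\<gamma>\<^sub>l(q) / \<gamma>(q)\<close> for \<open>q \<noteq> 0\<close>, and
  \<open>1 / L powr (1 / r)\<close> for \<open>q = 0\<close>. In both cases their \<open>r\<close>-th powers add up to one.\<close>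

lemma Br_normalised:
  fixes G :: "nat \<Rightarrow> real^'d^'d"
  assumes r: "r \<ge> 1" and L: "L \<ge> 1" and G: "\<And>l. l \<in> {1..L} \<Longrightarrow> sym_pos_def (G l)"
  shows "\<exists>y. (\<forall>l\<in>{1..L}. y l > 0) \<and> (\<Sum>l=1..L. y l powr r) = 1 \<and>
    Br r L G q p = (\<Sum>l=1..L. (gam_ratio r L G l p powr (r - 1) / y l) *\<^sub>R G l) \<and>
    (\<forall>l\<in>{1..L}. gam_l G l q \<le> y l * gam r L G q)"
proof (cases "q = 0")
  case False
  let ?y = "\<lambda>l. gam_l G l q / gam r L G q"
  have pos: "gam r L G q > 0" "\<And>l. l \<in> {1..L} \<Longrightarrow> gam_l G l q > 0"
    using False gam_pos[OF L G] gam_l_pos[OF G] by auto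
  show ?thesis
  proof (intro exI[of _ ?y] conjI)
    have "(\<Sum>l=1..L. ?y l powr r) = (\<Sum>l=1..L. gam_l G l q powr r) / gam r L G q powr r"
      using pos by (simp add: powr_divide less_imp_le sum_divide_distrib)
    then show "(\<Sum>l=1..L. ?y l powr r) = 1"
      using pos by (simp add: gam_powr[OF r, of L G, symmetric] del: One_nat_def)
  qed (use False pos in \<open>auto simp: Br_def scaleR_sum_right intro!: sum.cong,
      auto simp: field_simps\<close>)
next
  case True
  let ?y = "\<lambda>l::nat. 1 / real L powr (1 / r)"
  show ?thesis
  proof (intro exI[of _ ?y] conjI)
    show "(\<Sum>l=1..L. ?y l powr r) = 1"
      using r L by (simp add: powr_divide powr_powr)
  qed (use True L in \<open>auto simp: Br_def scaleR_sum_right intro!: sum.cong\<close>)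
qed

text \<open>The linearised operator controls the increment of the squared anisotropy, which makes the
  semi-implicit treatment of the gradient term stable.\<close>

lemma Br_energy_increment:
  fixes G :: "nat \<Rightarrow> real^'d^'d"
  assumes r: "r \<ge> 1" and L: "L \<ge> 1" and G: "\<And>l. l \<in> {1..L} \<Longrightarrow> sym_pos_def (G l)"
  shows "(Br r L G q p *v p) \<bullet> (p - q) \<ge> 1/2 * ((gam r L G p)\<^sup>2 - (gam r L G q)\<^sup>2)"
proof (cases "p = 0")
  case True
  then show ?thesis by simp
next
  case False
  define g x where "g = gam r L G p" and "x = (\<lambda>l. gam_l G l p / g)"
  have g: "g > 0"
    using gam_pos[OF L G False] by (simp add: g_def)
  have x: "x l > 0" if "l \<in> {1..L}" for l
    using that g gam_l_pos[OF G False] by (simp add: x_def)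
  have sum_x: "(\<Sum>l=1..L. x l powr r) = 1"
  proof -
    have "(\<Sum>l=1..L. x l powr r) = (\<Sum>l=1..L. gam_l G l p powr r) / g powr r"
      using g gam_l_pos[OF G False]
      by (simp add: x_def powr_divide less_imp_le sum_divide_distrib)
    then show ?thesis
      using g by (simp add: gam_powr[OF r, symmetric] g_def del: One_nat_def)
  qed
  obtain y where y: "\<And>l. l \<in> {1..L} \<Longrightarrow> y l > 0" and sum_y: "(\<Sum>l=1..L. y l powr r) = 1"
    and B: "Br r L G q p = (\<Sum>l=1..L. (gam_ratio r L G l p powr (r - 1) / y l) *\<^sub>R G l)"
    and q: "\<And>l. l \<in> {1..L} \<Longrightarrow> gam_l G l q \<le> y l * gam r L G q"
    using Br_normalised[of r L G q p, OF r L G] by blast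
  have Bz: "(Br r L G q p *v p) \<bullet> z = (\<Sum>l=1..L. x l powr (r - 1) / y l * (z \<bullet> (G l *v p)))" for z
    using False unfolding B matrix_vector_mult_sum_left
    by (simp add: inner_sum_right gam_ratio_def x_def g_def scaleR_matrix_vector_assoc[symmetric]
        inner_commute)
  have "(Br r L G q p *v p) \<bullet> p = g\<^sup>2 * (\<Sum>l=1..L. x l powr (r + 1) / y l)"
    unfolding Bz sum_distrib_left
  proof (rule sum.cong)
    fix l assume l: "l \<in> {1..L}"
    have "x l powr (r + 1) = x l powr (r - 1) * (x l)\<^sup>2"
      using x[OF l] powr_add[of "x l" "r - 1" 2] by (simp add: algebra_simps)
    moreover have "p \<bullet> (G l *v p) = g\<^sup>2 * (x l)\<^sup>2"
      using g by (simp add: gam_l_power2[of G l, OF G[OF l], symmetric] x_def power_divide)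
    ultimately show "x l powr (r - 1) / y l * (p \<bullet> (G l *v p)) = g\<^sup>2 * (x l powr (r + 1) / y l)"
      by simp
  qed simp
  also have "\<dots> \<ge> g\<^sup>2 * 1"
    using sum_powr_tangent[OF r x y sum_x sum_y] by (intro mult_left_mono) auto
  finally have lower: "(Br r L G q p *v p) \<bullet> p \<ge> g\<^sup>2"
    by simp
  have "(Br r L G q p *v p) \<bullet> q \<le> (\<Sum>l=1..L. x l powr r * (g * gam r L G q))"
    unfolding Bz
  proof (rule sum_mono)
    fix l assume l: "l \<in> {1..L}"
    have "gam_l G l q \<ge> 0"
      using gam_l_pos[of G l q, OF G[OF l]] by (cases "q = 0") auto
    have "q \<bullet> (G l *v p) \<le> gam_l G l p * gam_l G l q"
      by (rule gam_l_Cauchy_Schwarz[of G l, OF G[OF l]])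
    also have "\<dots> \<le> (g * x l) * (y l * gam r L G q)"
      using q[OF l] x[OF l] g \<open>gam_l G l q \<ge> 0\<close>
      by (intro mult_mono) (auto simp: x_def zero_less_divide_iff)
    finally have "x l powr (r - 1) / y l * (q \<bullet> (G l *v p))
        \<le> x l powr (r - 1) / y l * ((g * x l) * (y l * gam r L G q))"
      using x[OF l] y[OF l] by (intro mult_left_mono) auto
    also have "\<dots> = x l powr (r - 1) * x l * (g * gam r L G q)"
      using y[OF l] by simp
    also have "x l powr (r - 1) * x l = x l powr r"
      using x[OF l] powr_add[of "x l" "r - 1" 1] by simp
    finally show "x l powr (r - 1) / y l * (q \<bullet> (G l *v p)) \<le> x l powr r * (g * gam r L G q)" .
  qed
  also have "\<dots> = g * gam r L G q"
    by (simp only: sum_distrib_right[symmetric] sum_x mult_1_left)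
  also have "\<dots> \<le> 1/2 * g\<^sup>2 + 1/2 * (gam r L G q)\<^sup>2"
    using zero_le_power2[of "g - gam r L G q"] by (simp add: power2_diff)
  finally have "(Br r L G q p *v p) \<bullet> q \<le> 1/2 * g\<^sup>2 + 1/2 * (gam r L G q)\<^sup>2" .
  with lower show ?thesis
    by (simp add: inner_diff_right g_def)
qed

section \<open>Shape function and potential\<close>

lemma Pfun_has_real_derivative:
  assumes "continuous_on UNIV f"
  shows "(Pfun f has_real_derivative f s) (at s)"
proof -
  define lo hi where "lo = min (-1) s - 1" and "hi = max (-1) s + 1"
  have "((\<lambda>u. LBINT y=ereal (-1)..u. f y) has_vector_derivative f s) (at s within {lo..hi})"
    using assms by (intro interval_integral_FTC2)
      (auto simp: lo_def hi_def intro: continuous_on_subset)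
  moreover have "at s within {lo..hi} = at s"
    by (rule at_within_interior) (auto simp: lo_def hi_def)
  moreover have "ereal (-1) = -1"
    by (simp add: one_ereal_def)
  ultimately show ?thesis
    unfolding Pfun_def [abs_def] has_real_derivative_iff_has_vector_derivative by simp
qed

lemma c_Psi_pos: "c_Psi > 0"
proof -
  \<comment> \<open>The truncation extends the integrand continuously beyond the interval, so that the mean
    value theorem applies to its primitive.\<close>
  define f where "f = (\<lambda>s::real. sqrt (max 0 (1 - s\<^sup>2)))"
  have "c_Psi = Pfun f 1"
    unfolding c_Psi_def Pfun_def one_ereal_def
  proof (rule interval_integral_cong)
    fix s assume "s \<in> einterval (min (- ereal 1) (ereal 1)) (max (- ereal 1) (ereal 1))"
    then have "\<bar>s\<bar> \<le> 1"
      by (auto simp: einterval_def min_def max_def one_ereal_def split: if_splits)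
    moreover have "s\<^sup>2 \<le> 1"
      using \<open>\<bar>s\<bar> \<le> 1\<close> by (simp add: abs_square_le_1)
    ultimately show "sqrt (2 * real_of_ereal (obstacle_pot s)) = f s"
      by (simp add: obstacle_pot_def f_def)
  qed
  moreover have "Pfun f (-1) = 0"
    by (simp add: Pfun_def one_ereal_def)
  moreover have "\<exists>z>-1. z < 1 \<and> Pfun f 1 - Pfun f (-1) = (1 - (-1)) * f z"
    by (rule MVT2) (auto intro!: Pfun_has_real_derivative continuous_intros simp: f_def)
  moreover have "f z > 0" if "-1 < z" "z < 1" for z
    using that abs_square_less_1[of z] by (simp add: f_def)
  ultimately show ?thesis by fastforce
qed

lemma antimono_from_deriv:
  fixes f :: "real \<Rightarrow> real"
  assumes "f C1_differentiable_on UNIV" "\<And>s. s \<in> {-1..1} \<Longrightarrow> c * deriv f s \<le> 0"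
    and "-1 \<le> s" "s \<le> t" "t \<le> 1"
  shows "c * f t \<le> c * f s"
proof (rule DERIV_nonpos_imp_nonincreasing[where f = "\<lambda>s. c * f s", OF \<open>s \<le> t\<close>])
  fix x assume "s \<le> x" "x \<le> t"
  have "f differentiable at x"
    using assms(1) by (simp add: C1_differentiable_on_eq)
  then have "(f has_real_derivative deriv f x) (at x)"
    using DERIV_deriv_iff_real_differentiable by blast
  then have "((\<lambda>s. c * f s) has_real_derivative c * deriv f x) (at x)"
    by (rule DERIV_cmult)
  moreover have "c * deriv f x \<le> 0"
    using assms \<open>s \<le> x\<close> \<open>x \<le> t\<close> by auto
  ultimately show "\<exists>y. ((\<lambda>s. c * f s) has_real_derivative y) (at x) \<and> y \<le> 0"
    by blast
qed

text \<open>For a splitting adapted to the sign of \<open>c\<close>, the discrete increment \<open>rho_hat s t * (t - s)\<close>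
  is dominated, after multiplication by \<open>c\<close>, by the increment of the primitive. The mean value theorem replaces the latter by \<open>\<rho>s z * (t - s)\<close>
  with \<open>z\<close> between \<open>s\<close> and \<open>t\<close>.\<close>

lemma rho_hat_increment:
  assumes cont: "continuous_on UNIV \<rho>s" and split: "\<And>s. \<rho>s s = \<rho>p s + \<rho>m s"
    and C1: "\<rho>p C1_differentiable_on UNIV" "\<rho>m C1_differentiable_on UNIV"
    and sgn: "\<And>s. s \<in> {-1..1} \<Longrightarrow> c * deriv \<rho>p s \<le> 0" "\<And>s. s \<in> {-1..1} \<Longrightarrow> - c * deriv \<rho>m s \<le> 0"
    and st: "\<bar>s\<bar> \<le> 1" "\<bar>t\<bar> \<le> 1"
  shows "c * (rho_hat \<rho>p \<rho>m s t * (t - s)) \<le> c * (Pfun \<rho>s t - Pfun \<rho>s s)"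
proof -
  note anti_p = antimono_from_deriv[OF C1(1) sgn(1)]
  note anti_m = antimono_from_deriv[OF C1(2) sgn(2), simplified]
  consider "s < t" | "s = t" | "t < s" by linarith
  then show ?thesis
  proof cases
    case 1
    obtain z where z: "s < z" "z < t" "Pfun \<rho>s t - Pfun \<rho>s s = (t - s) * \<rho>s z"
      using MVT2[OF 1 Pfun_has_real_derivative[OF cont]] by blast
    have "c * \<rho>p t \<le> c * \<rho>p z" "c * \<rho>m s \<le> c * \<rho>m z"
      using anti_p[of z t] anti_m[of s z] z st by auto
    then have "(c * \<rho>p t + c * \<rho>m s) * (t - s) \<le> (c * \<rho>p z + c * \<rho>m z) * (t - s)"
      using 1 by (intro mult_right_mono) auto
    then show ?thesis
      by (simp only: z rho_hat_def split, simp add: algebra_simps)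
  next
    case 3
    obtain z where z: "t < z" "z < s" "Pfun \<rho>s s - Pfun \<rho>s t = (s - t) * \<rho>s z"
      using MVT2[OF 3 Pfun_has_real_derivative[OF cont]] by blast
    have "c * \<rho>p z \<le> c * \<rho>p t" "c * \<rho>m z \<le> c * \<rho>m s"
      using anti_p[of t z] anti_m[of z s] z st by auto
    then have "(c * \<rho>p z + c * \<rho>m z) * (s - t) \<le> (c * \<rho>p t + c * \<rho>m s) * (s - t)"
      using 3 by (intro mult_right_mono) auto
    moreover have eq: "Pfun \<rho>s t - Pfun \<rho>s s = (t - s) * \<rho>s z"
      using z by (simp add: algebra_simps)
    ultimately show ?thesis
      unfolding eq by (simp add: rho_hat_def split algebra_simps)
  qed simp
qed

section \<open>Quadrature and integration over the mesh\<close>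

text \<open>The quadrature rule of the lumped product, applied to prescribed vertex values. A value may
  depend on the element from which the vertex is approached, since gradients jump across faces.\<close>

definition vertex_sum ::
  "(real^'d) set set \<Rightarrow> ((real^'d) set \<Rightarrow> real^'d \<Rightarrow> real) \<Rightarrow> real" where
  "vertex_sum \<T> F =
     (\<Sum>\<sigma>\<in>\<T>. measure lebesgue \<sigma> / (real CARD('d) + 1) * (\<Sum>p\<in>vertices \<sigma>. F \<sigma> p))"

lemma vertex_sum_add:
  "vertex_sum \<T> (\<lambda>\<sigma> p. F \<sigma> p + H \<sigma> p) = vertex_sum \<T> F + vertex_sum \<T> H"
  by (simp add: vertex_sum_def sum.distrib ring_distribs)

lemma vertex_sum_diff:
  "vertex_sum \<T> (\<lambda>\<sigma> p. F \<sigma> p - H \<sigma> p) = vertex_sum \<T> F - vertex_sum \<T> H"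
  by (simp add: vertex_sum_def sum_subtractf ring_distribs)

lemma vertex_sum_cmult: "vertex_sum \<T> (\<lambda>\<sigma> p. c * F \<sigma> p) = c * vertex_sum \<T> F"
  by (simp add: vertex_sum_def sum_distrib_left mult.left_commute)

lemma vertex_sum_mono:
  assumes "\<And>\<sigma> p. \<sigma> \<in> \<T> \<Longrightarrow> p \<in> vertices \<sigma> \<Longrightarrow> F \<sigma> p \<le> H \<sigma> p"
  shows "vertex_sum \<T> F \<le> vertex_sum \<T> H"
  unfolding vertex_sum_def using assms by (intro sum_mono mult_left_mono) auto

lemma vertex_sum_nonneg:
  assumes "\<And>\<sigma> p. \<sigma> \<in> \<T> \<Longrightarrow> p \<in> vertices \<sigma> \<Longrightarrow> 0 \<le> F \<sigma> p"
  shows "0 \<le> vertex_sum \<T> F"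
  unfolding vertex_sum_def using assms by (intro sum_nonneg mult_nonneg_nonneg) auto

lemma element_properties:
  fixes \<Omega> :: "(real^'d) set"
  assumes "simplicial_partition \<T> \<Omega>" "\<sigma> \<in> \<T>"
  shows "open \<sigma>" "convex \<sigma>" "bounded \<sigma>" "\<sigma> \<noteq> {}"
proof -
  obtain S :: "(real^'d) set" where S: "int CARD('d) simplex S" "\<sigma> = interior S"
    using assms by (auto simp: simplicial_partition_def)
  then show "open \<sigma>" "convex \<sigma>" "bounded \<sigma>"
    using convex_simplex[OF S(1)] compact_simplex[OF S(1)]
    by (auto simp: convex_interior bounded_interior compact_imp_bounded)
  have "interior S = rel_interior S"
    using aff_dim_simplex[OF S(1)] aff_dim_eq_full[of S] rel_interior_interior[of S] by simp
  moreover have "S \<noteq> {}"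
    using S(1) by auto
  ultimately show "\<sigma> \<noteq> {}"
    using S rel_interior_eq_empty[OF convex_simplex[OF S(1)]] by auto
qed

lemma element_lmeasurable:
  assumes "simplicial_partition \<T> \<Omega>" "\<sigma> \<in> \<T>"
  shows "\<sigma> \<in> lmeasurable"
  using element_properties[OF assms] by (simp add: lmeasurable_open)

lemma vertex_in_closure: "p \<in> vertices \<sigma> \<Longrightarrow> p \<in> closure \<sigma>"
  by (simp add: vertices_def extreme_point_of_def)

lemma element_closure_subset:
  assumes "simplicial_partition \<T> \<Omega>" "\<sigma> \<in> \<T>"
  shows "closure \<sigma> \<subseteq> closure \<Omega>"
  using assms by (intro closure_mono) (auto simp: simplicial_partition_def)

lemma at_vertex_nontrivial:
  assumes "simplicial_partition \<T> \<Omega>" "\<sigma> \<in> \<T>" "p \<in> vertices \<sigma>"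
  shows "at p within \<sigma> \<noteq> bot"
proof -
  have "p islimpt \<sigma>"
  proof (cases "p \<in> \<sigma>")
    case True
    then show ?thesis
      using element_properties(1)[OF assms(1,2)] by (simp add: interior_limit_point interior_open)
  next
    case False
    then show ?thesis
      using vertex_in_closure[OF assms(3)] by (simp add: closure_def)
  qed
  then show ?thesis
    by (simp add: trivial_limit_within)
qed

lemma lumped_eq_vertex_sum:
  assumes "simplicial_partition \<T> \<Omega>"
    and "\<And>\<sigma> p. \<sigma> \<in> \<T> \<Longrightarrow> p \<in> vertices \<sigma> \<Longrightarrow> (f \<longlongrightarrow> F \<sigma> p) (at p within \<sigma>)"
    and "\<And>\<sigma> p. \<sigma> \<in> \<T> \<Longrightarrow> p \<in> vertices \<sigma> \<Longrightarrow> (g \<longlongrightarrow> H \<sigma> p) (at p within \<sigma>)"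
    and "\<And>\<sigma> p. \<sigma> \<in> \<T> \<Longrightarrow> p \<in> vertices \<sigma> \<Longrightarrow> F \<sigma> p * H \<sigma> p = K \<sigma> p"
  shows "lumped \<T> f g = vertex_sum \<T> K"
proof -
  have "Lim (at p within \<sigma>) (\<lambda>x. f x * g x) = K \<sigma> p" if p: "\<sigma> \<in> \<T>" "p \<in> vertices \<sigma>" for \<sigma> p
    using tendsto_Lim[OF at_vertex_nontrivial[OF assms(1) p] tendsto_mult[OF assms(2,3)[OF p]]]
      assms(4)[OF p] by simp
  then show ?thesis
    by (simp add: lumped_def vertex_sum_def)
qed

lemma lumped_ereal_eq_vertex_sum:
  assumes "simplicial_partition \<T> \<Omega>"
    and "\<And>\<sigma> p. \<sigma> \<in> \<T> \<Longrightarrow> p \<in> vertices \<sigma> \<Longrightarrow>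
      ((\<lambda>x. f x * g x) \<longlongrightarrow> ereal (F \<sigma> p)) (at p within \<sigma>)"
  shows "lumped_ereal \<T> f g = ereal (vertex_sum \<T> F)"
proof -
  have "Lim (at p within \<sigma>) (\<lambda>x. f x * g x) = ereal (F \<sigma> p)" if "\<sigma> \<in> \<T>" "p \<in> vertices \<sigma>" for \<sigma> p
    using that by (intro tendsto_Lim assms at_vertex_nontrivial[OF assms(1)])
  then show ?thesis
    by (simp add: lumped_ereal_def vertex_sum_def)
qed

text \<open>The elements exhaust the domain up to their boundaries, which are null sets. Hence the values
  of an integrand on the mesh skeleton play no role.\<close>

lemma L2_inner_elementwise_constant:
  fixes f g :: "real^'d \<Rightarrow> 'b::real_inner"
  assumes mesh: "simplicial_partition \<T> \<Omega>"
    and const: "\<And>\<sigma> x. \<sigma> \<in> \<T> \<Longrightarrow> x \<in> \<sigma> \<Longrightarrow> f x \<bullet> g x = c \<sigma>"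
  shows "L2_inner \<Omega> f g = (\<Sum>\<sigma>\<in>\<T>. measure lebesgue \<sigma> * c \<sigma>)"
proof -
  let ?h = "\<lambda>x. f x \<bullet> g x"
  have fin: "finite \<T>" and disj: "pairwise disjnt \<T>" and sub: "\<Union>\<T> \<subseteq> \<Omega>"
    and clos: "closure \<Omega> = (\<Union>\<sigma>\<in>\<T>. closure \<sigma>)"
    using mesh by (auto simp: simplicial_partition_def)
  have "negligible (\<Union>\<sigma>\<in>\<T>. frontier \<sigma>)"
    using fin element_properties(2)[OF mesh]
    by (auto intro!: negligible_Union negligible_convex_frontier)
  moreover have "\<Omega> - \<Union>\<T> \<subseteq> (\<Union>\<sigma>\<in>\<T>. frontier \<sigma>)"
    using closure_subset[of \<Omega>] clos element_properties(1)[OF mesh]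
    by (auto simp: frontier_def interior_open) blast
  ultimately have null: "negligible (\<Omega> - \<Union>\<T>)"
    using negligible_subset by blast
  have int: "(k has_integral (\<Sum>\<sigma>\<in>\<T>. measure lebesgue \<sigma> * e \<sigma>)) \<Omega>"
    if k: "\<And>\<sigma> x. \<sigma> \<in> \<T> \<Longrightarrow> x \<in> \<sigma> \<Longrightarrow> k x = e \<sigma>" for k :: "real^'d \<Rightarrow> real" and e
  proof -
    have "(k has_integral measure lebesgue \<sigma> * e \<sigma>) \<sigma>" if "\<sigma> \<in> \<T>" for \<sigma>
    proof -
      have "((\<lambda>x. 1 * e \<sigma>) has_integral measure lebesgue \<sigma> * e \<sigma>) \<sigma>"
        using element_lmeasurable[OF mesh that] by (intro has_integral_mult_left)
          (simp add: lmeasure_integral integrable_integral integrable_on_const)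
      then show ?thesis
        by (rule has_integral_eq[rotated]) (simp add: k[OF that])
    qed
    then have "(k has_integral (\<Sum>\<sigma>\<in>\<T>. measure lebesgue \<sigma> * e \<sigma>)) (\<Union>\<sigma>\<in>\<T>. \<sigma>)"
      using disj fin by (intro has_integral_UN) (auto simp: pairwise_def disjnt_def)
    moreover have "negligible {x \<in> \<Union>\<T> - \<Omega>. k x \<noteq> 0}"
      by (rule negligible_subset[OF negligible_empty]) (use sub in blast)
    moreover have "negligible {x \<in> \<Omega> - \<Union>\<T>. k x \<noteq> 0}"
      by (rule negligible_subset[OF null]) blast
    ultimately show ?thesis
      using has_integral_spike_set_eq[of \<Omega> "\<Union>\<T>" k] by (simp only: image_ident)
  qed
  have "(\<lambda>x. norm (?h x)) integrable_on \<Omega>"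
    by (rule has_integral_integrable[OF int[where e = "\<lambda>\<sigma>. \<bar>c \<sigma>\<bar>"]]) (simp add: const)
  moreover have h: "(?h has_integral (\<Sum>\<sigma>\<in>\<T>. measure lebesgue \<sigma> * c \<sigma>)) \<Omega>"
    by (rule int) (rule const)
  ultimately have "?h absolutely_integrable_on \<Omega>"
    by (simp add: absolutely_integrable_on_def has_integral_integrable)
  then show ?thesis
    using h unfolding L2_inner_def
    by (simp add: set_lebesgue_integral_eq_integral integral_unique)
qed

section \<open>Finite element functions\<close>

lemma grad_eqI:
  assumes "GDERIV f x :> D"
  shows "grad f x = D"
  unfolding grad_def
proof (rule the_equality)
  show "GDERIV f x :> D" by fact
  fix D' assume "GDERIV f x :> D'"
  then have "(\<lambda>h. h \<bullet> D') = (\<lambda>h. h \<bullet> D)"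
    using assms by (auto simp: gderiv_def intro: has_derivative_unique)
  then show "D' = D"
    by (metis inner_commute vector_eq_rdot)
qed

text \<open>This holds even where \<open>f\<close> is not differentiable, since both sides are then determined by the
  same unsatisfiable condition.\<close>

lemma grad_diff_const: "grad (\<lambda>x. f x - c) = grad f"
proof -
  have "GDERIV (\<lambda>x. f x - c) x :> D \<longleftrightarrow> GDERIV f x :> D" for x D
  proof
    assume "GDERIV (\<lambda>x. f x - c) x :> D"
    then have "((\<lambda>x. (f x - c) + c) has_derivative (\<lambda>h. h \<bullet> D + 0)) (at x)"
      unfolding gderiv_def by (intro has_derivative_add has_derivative_const)
    then show "GDERIV f x :> D"
      by (simp add: gderiv_def)
  next
    assume "GDERIV f x :> D"
    then have "((\<lambda>x. f x - c) has_derivative (\<lambda>h. h \<bullet> D - 0)) (at x)"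
      unfolding gderiv_def by (intro has_derivative_diff has_derivative_const)
    then show "GDERIV (\<lambda>x. f x - c) x :> D"
      by (simp add: gderiv_def)
  qed
  then show ?thesis
    by (simp add: grad_def fun_eq_iff)
qed

lemma Sh_diff:
  assumes "f \<in> Sh \<Omega> \<T>" "g \<in> Sh \<Omega> \<T>"
  shows "(\<lambda>x. f x - g x) \<in> Sh \<Omega> \<T>"
  unfolding Sh_def
proof (intro CollectI conjI ballI)
  show "continuous_on (closure \<Omega>) (\<lambda>x. f x - g x)"
    using assms by (auto simp: Sh_def intro: continuous_on_diff)
  fix \<sigma> assume "\<sigma> \<in> \<T>"
  then obtain v c w d where "\<forall>x\<in>\<sigma>. f x = v \<bullet> x + c" "\<forall>x\<in>\<sigma>. g x = w \<bullet> x + d"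
    using assms by (fastforce simp: Sh_def)
  then have "\<forall>x\<in>\<sigma>. f x - g x = (v - w) \<bullet> x + (c - d)"
    by (simp add: inner_diff_left)
  then show "\<exists>v c. \<forall>x\<in>\<sigma>. f x - g x = v \<bullet> x + c"
    by blast
qed

lemma Sh_const: "(\<lambda>x. c) \<in> Sh \<Omega> \<T>"
  unfolding Sh_def by (auto intro!: exI[of _ 0] exI[of _ c])

lemma elementwise_gradient:
  assumes mesh: "simplicial_partition \<T> \<Omega>" and f: "f \<in> Sh \<Omega> \<T>"
  obtains v where "\<And>\<sigma> x. \<sigma> \<in> \<T> \<Longrightarrow> x \<in> \<sigma> \<Longrightarrow> GDERIV f x :> v \<sigma>"
proof -
  have "\<forall>\<sigma>\<in>\<T>. \<exists>v. \<forall>x\<in>\<sigma>. GDERIV f x :> v"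
  proof
    fix \<sigma> assume \<sigma>: "\<sigma> \<in> \<T>"
    then obtain v c where v: "\<forall>x\<in>\<sigma>. f x = v \<bullet> x + c"
      using f unfolding Sh_def by blast
    have "GDERIV f x :> v" if "x \<in> \<sigma>" for x
    proof -
      have "((\<lambda>x. v \<bullet> x + c) has_derivative (\<lambda>h. h \<bullet> v)) (at x)"
        by (auto intro!: derivative_eq_intros simp: inner_commute)
      then show ?thesis
        unfolding gderiv_def using element_properties(1)[OF mesh \<sigma>] that v
        by (auto intro: has_derivative_transform_within_open)
    qed
    then show "\<exists>v. \<forall>x\<in>\<sigma>. GDERIV f x :> v" by blast
  qed
  then obtain v where "\<forall>\<sigma>\<in>\<T>. \<forall>x\<in>\<sigma>. GDERIV f x :> v \<sigma>"
    using bchoice[of \<T> "\<lambda>\<sigma> v. \<forall>x\<in>\<sigma>. GDERIV f x :> v"] by blast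
  then show ?thesis
    using that by blast
qed

lemma Sh_tendsto_vertex:
  assumes mesh: "simplicial_partition \<T> \<Omega>" and "f \<in> Sh \<Omega> \<T>" "\<sigma> \<in> \<T>" "p \<in> vertices \<sigma>"
  shows "(f \<longlongrightarrow> f p) (at p within \<sigma>)"
proof -
  have "p \<in> closure \<Omega>" "\<sigma> \<subseteq> closure \<Omega>"
    using element_closure_subset[OF mesh assms(3)] vertex_in_closure[OF assms(4)]
      closure_subset[of \<sigma>] by auto
  moreover have "continuous_on (closure \<Omega>) f"
    using assms by (simp add: Sh_def)
  ultimately show ?thesis
    by (auto simp: continuous_on_def intro: tendsto_within_subset)
qed

lemma tendsto_vertex_const:
  assumes "\<And>x. x \<in> \<sigma> \<Longrightarrow> f x = c"
  shows "(f \<longlongrightarrow> c) (at p within \<sigma>)"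
  by (rule tendsto_eventually) (simp add: eventually_at_filter assms)

lemma Kh_vertex_bound:
  assumes mesh: "simplicial_partition \<T> \<Omega>" and f: "f \<in> Kh \<Omega> \<T>" and p: "\<sigma> \<in> \<T>" "p \<in> vertices \<sigma>"
  shows "\<bar>f p\<bar> \<le> 1"
proof -
  have "((\<lambda>x. \<bar>f x\<bar>) \<longlongrightarrow> \<bar>f p\<bar>) (at p within \<sigma>)"
    using f p by (intro tendsto_rabs Sh_tendsto_vertex[OF mesh]) (auto simp: Kh_def)
  moreover have "eventually (\<lambda>x. \<bar>f x\<bar> \<le> 1) (at p within \<sigma>)"
    using f mesh p(1)
    by (auto simp: eventually_at_filter Kh_def simplicial_partition_def intro!: always_eventually)
  ultimately show ?thesis
    using tendsto_upperbound at_vertex_nontrivial[OF mesh p] by blast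
qed

section \<open>The discrete energies in finite form\<close>

lemma lumped_nrm_square:
  assumes mesh: "simplicial_partition \<T> \<Omega>"
    and "\<And>\<sigma> p. \<sigma> \<in> \<T> \<Longrightarrow> p \<in> vertices \<sigma> \<Longrightarrow> (f \<longlongrightarrow> F \<sigma> p) (at p within \<sigma>)"
  shows "(lumped_nrm \<T> f)\<^sup>2 = vertex_sum \<T> (\<lambda>\<sigma> p. (F \<sigma> p)\<^sup>2)"
proof -
  have "lumped \<T> f f = vertex_sum \<T> (\<lambda>\<sigma> p. (F \<sigma> p)\<^sup>2)"
    by (rule lumped_eq_vertex_sum[OF mesh assms(2) assms(2)]) (simp_all add: power2_eq_square)
  moreover have "vertex_sum \<T> (\<lambda>\<sigma> p. (F \<sigma> p)\<^sup>2) \<ge> 0"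
    by (rule vertex_sum_nonneg) simp
  ultimately show ?thesis
    by (simp add: lumped_nrm_def)
qed

text \<open>For \<open>\<Phi>\<close> in \<open>Kh\<close> the potential is finite inside every element, hence the energy is a real
  number.\<close>

lemma Eh_eq_real:
  assumes mesh: "simplicial_partition \<T> \<Omega>" and W: "W \<in> Sh \<Omega> \<T>" and \<Phi>: "\<Phi> \<in> Kh \<Omega> \<T>"
    and v: "\<And>\<sigma> x. \<sigma> \<in> \<T> \<Longrightarrow> x \<in> \<sigma> \<Longrightarrow> grad \<Phi> x = v \<sigma>"
  shows "Eh \<Omega> \<T> \<epsilon> \<theta> lam \<alpha> a uD \<gamma> W \<Phi> =
    ereal (\<theta> / 2 * vertex_sum \<T> (\<lambda>\<sigma> p. (W p - uD)\<^sup>2)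
      + lam * \<alpha> / (a * c_Psi) * (1/2 * \<epsilon> * (\<Sum>\<sigma>\<in>\<T>. measure lebesgue \<sigma> * (\<gamma> (v \<sigma>))\<^sup>2)
        + inverse \<epsilon> * vertex_sum \<T> (\<lambda>\<sigma> p. 1/2 * (1 - (\<Phi> p)\<^sup>2))))"
proof -
  have "(lumped_nrm \<T> (\<lambda>x. W x - uD))\<^sup>2 = vertex_sum \<T> (\<lambda>\<sigma> p. (W p - uD)\<^sup>2)"
    by (intro lumped_nrm_square[OF mesh] tendsto_intros Sh_tendsto_vertex[OF mesh W])
  moreover have "(L2_nrm \<Omega> (\<lambda>x. \<gamma> (grad \<Phi> x)))\<^sup>2 = (\<Sum>\<sigma>\<in>\<T>. measure lebesgue \<sigma> * (\<gamma> (v \<sigma>))\<^sup>2)"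
  proof -
    have "L2_inner \<Omega> (\<lambda>x. \<gamma> (grad \<Phi> x)) (\<lambda>x. \<gamma> (grad \<Phi> x))
        = (\<Sum>\<sigma>\<in>\<T>. measure lebesgue \<sigma> * (\<gamma> (v \<sigma>))\<^sup>2)"
      by (rule L2_inner_elementwise_constant[OF mesh]) (simp add: v power2_eq_square)
    moreover have "(\<Sum>\<sigma>\<in>\<T>. measure lebesgue \<sigma> * (\<gamma> (v \<sigma>))\<^sup>2) \<ge> 0"
      by (intro sum_nonneg) simp
    ultimately show ?thesis
      by (simp add: L2_nrm_def)
  qed
  moreover have "lumped_ereal \<T> (\<lambda>x. obstacle_pot (\<Phi> x)) (\<lambda>x. 1)
      = ereal (vertex_sum \<T> (\<lambda>\<sigma> p. 1/2 * (1 - (\<Phi> p)\<^sup>2)))"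
  proof (rule lumped_ereal_eq_vertex_sum[OF mesh])
    fix \<sigma> p assume p: "\<sigma> \<in> \<T>" "p \<in> vertices \<sigma>"
    have "\<Phi> \<in> Sh \<Omega> \<T>"
      using \<Phi> by (simp add: Kh_def)
    then have "((\<lambda>x. ereal (1/2 * (1 - (\<Phi> x)\<^sup>2))) \<longlongrightarrow> ereal (1/2 * (1 - (\<Phi> p)\<^sup>2))) (at p within \<sigma>)"
      by (intro tendsto_intros Sh_tendsto_vertex[OF mesh _ p])
    moreover have "eventually (\<lambda>x. obstacle_pot (\<Phi> x) * 1 = ereal (1/2 * (1 - (\<Phi> x)\<^sup>2)))
        (at p within \<sigma>)"
      using \<Phi> mesh p(1)
      by (auto simp: eventually_at_filter Kh_def simplicial_partition_def obstacle_pot_def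
          intro!: always_eventually)
    ultimately show "((\<lambda>x. obstacle_pot (\<Phi> x) * 1) \<longlongrightarrow> ereal (1/2 * (1 - (\<Phi> p)\<^sup>2))) (at p within \<sigma>)"
      by (simp only: tendsto_cong)
  qed
  ultimately show ?thesis
    by (simp add: Eh_def)
qed

section \<open>The energy estimate\<close>

lemma C1_imp_continuous_on:
  fixes f :: "real \<Rightarrow> real"
  assumes "f C1_differentiable_on UNIV"
  shows "continuous_on UNIV f"
  using assms by (simp add: C1_differentiable_on_eq differentiable_at_imp_differentiable_on
      differentiable_imp_continuous_on)

lemma tendsto_of_continuous:
  fixes g :: "real \<Rightarrow> real"
  assumes "continuous_on UNIV g" "(f \<longlongrightarrow> l) F"
  shows "((\<lambda>x. g (f x)) \<longlongrightarrow> g l) F"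
  by (rule isCont_tendsto_compose[OF _ assms(2)])
    (use assms(1) in \<open>simp add: continuous_on_eq_continuous_at\<close>)

lemma mu_fun_nonneg:
  assumes \<gamma>: "\<And>p. \<gamma> p \<ge> 0" and \<beta>: "\<And>p. \<beta> p \<ge> 0" and mubar: "mubar \<ge> \<gamma> p1 / \<beta> p1"
  shows "mu_fun \<gamma> \<beta> mubar p \<ge> 0"
proof -
  have ratio: "0 \<le> \<gamma> q / \<beta> q" for q
    using \<gamma> \<beta> by simp
  have "0 \<le> mubar"
    using ratio[of p1] mubar by linarith
  then show ?thesis
    using ratio[of p] by (simp add: mu_fun_def)
qed

text \<open>The estimate follows by testing the heat equation with \<open>W1 - uD\<close> and the variational
  inequality with \<open>\<Phi>0\<close>; the terms with the product of \<open>rho_hat\<close>, \<open>W1\<close> and \<open>\<Phi>1 - \<Phi>0\<close>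
  (\<open>Q\<close> in the proof) then cancel. Here \<open>v0\<close> and \<open>v1\<close> are the elementwise gradients of \<open>\<Phi>0\<close> and \<open>\<Phi>1\<close>.\<close>

lemma obstacle_step_energy_inequality:
  fixes \<Omega> dD :: "(real^'d) set" and G :: "nat \<Rightarrow> real^'d^'d" and uD :: real
    and \<rho>p \<rho>m :: "real \<Rightarrow> real"
  defines "rh \<equiv> rho_hat \<rho>p \<rho>m"
  assumes mesh: "simplicial_partition \<T> \<Omega>"
    and params: "\<epsilon> > 0" "\<theta> \<ge> 0" "lam > 0" "\<alpha> > 0" "a > 0" "\<tau> > 0"
    and aniso: "r \<ge> 1" "L \<ge> 1" "\<And>l. l \<in> {1..L} \<Longrightarrow> sym_pos_def (G l)"
    and cont: "continuous_on UNIV \<rho>p" "continuous_on UNIV \<rho>m"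
    and previous: "\<Phi>0 \<in> Kh \<Omega> \<T>" "W0 \<in> Sh \<Omega> \<T>"
    and solution: "obstacle_step \<Omega> \<T> dD \<epsilon> \<theta> lam \<rho> \<alpha> a uD b rh \<mu> (Br r L G) \<tau> \<Phi>0 W0 \<Phi>1 W1"
    and v0: "\<And>\<sigma> x. \<sigma> \<in> \<T> \<Longrightarrow> x \<in> \<sigma> \<Longrightarrow> GDERIV \<Phi>0 x :> v0 \<sigma>"
    and v1: "\<And>\<sigma> x. \<sigma> \<in> \<T> \<Longrightarrow> x \<in> \<sigma> \<Longrightarrow> GDERIV \<Phi>1 x :> v1 \<sigma>"
  shows "\<theta> / 2 * vertex_sum \<T> (\<lambda>\<sigma> p. (W1 p - uD)\<^sup>2)
      + lam * \<alpha> / (a * c_Psi) * (1/2 * \<epsilon> * (\<Sum>\<sigma>\<in>\<T>. measure lebesgue \<sigma> * (gam r L G (v1 \<sigma>))\<^sup>2)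
        + inverse \<epsilon> * vertex_sum \<T> (\<lambda>\<sigma> p. 1/2 * (1 - (\<Phi>1 p)\<^sup>2)))
      - uD * lam * vertex_sum \<T> (\<lambda>\<sigma> p. rh (\<Phi>0 p) (\<Phi>1 p) * (\<Phi>1 p - \<Phi>0 p))
      + \<tau> * L2_inner \<Omega> (\<lambda>x. nodal_interp \<Omega> \<T> (\<lambda>y. b (\<Phi>0 y)) x *\<^sub>R grad W1 x) (grad W1)
      + \<tau> * (lam * \<rho> / a) * (\<epsilon> / c_Psi) *
          vertex_sum \<T> (\<lambda>\<sigma> p. \<mu> (v0 \<sigma>) * ((\<Phi>1 p - \<Phi>0 p) / \<tau>)\<^sup>2)
    \<le> \<theta> / 2 * vertex_sum \<T> (\<lambda>\<sigma> p. (W0 p - uD)\<^sup>2)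
      + lam * \<alpha> / (a * c_Psi) * (1/2 * \<epsilon> * (\<Sum>\<sigma>\<in>\<T>. measure lebesgue \<sigma> * (gam r L G (v0 \<sigma>))\<^sup>2)
        + inverse \<epsilon> * vertex_sum \<T> (\<lambda>\<sigma> p. 1/2 * (1 - (\<Phi>0 p)\<^sup>2)))"
proof -
  let ?V = "vertex_sum \<T>"
  let ?D = "\<lambda>p. \<Phi>1 p - \<Phi>0 p"
  let ?rh = "\<lambda>p. rh (\<Phi>0 p) (\<Phi>1 p)"
  let ?X = "L2_inner \<Omega> (\<lambda>x. nodal_interp \<Omega> \<T> (\<lambda>y. b (\<Phi>0 y)) x *\<^sub>R grad W1 x) (grad W1)"
  let ?B = "\<Sum>\<sigma>\<in>\<T>. measure lebesgue \<sigma> * ((Br r L G (v0 \<sigma>) (v1 \<sigma>) *v v1 \<sigma>) \<bullet> (v1 \<sigma> - v0 \<sigma>))"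
  let ?S = "\<lambda>v. \<Sum>\<sigma>\<in>\<T>. measure lebesgue \<sigma> * (gam r L G (v \<sigma>))\<^sup>2"
  \<comment> \<open>The scaling that turns the factor of the coupling term into \<open>lam\<close>.\<close>
  define k where "k = lam * \<alpha> / (a * c_Psi)"
  have k: "k > 0" "k * (c_Psi * (a / \<alpha>)) = lam"
    using params c_Psi_pos by (auto simp: k_def)
  define M where "M = ?V (\<lambda>\<sigma> p. \<mu> (v0 \<sigma>) * (?D p)\<^sup>2 / \<tau>)"
  define Q where "Q = ?V (\<lambda>\<sigma> p. ?rh p * W1 p * ?D p)"
  define R where "R = ?V (\<lambda>\<sigma> p. ?rh p * ?D p)"
  define N where "N = ?V (\<lambda>\<sigma> p. \<Phi>0 p * ?D p)"
  define Z where "Z = ?V (\<lambda>\<sigma> p. (W1 p - W0 p) * (W1 p - uD))"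
  have \<Phi>: "\<Phi>0 \<in> Sh \<Omega> \<T>" "\<Phi>1 \<in> Sh \<Omega> \<T>" and W: "W1 \<in> Sh \<Omega> \<T>"
    using solution previous by (auto simp: obstacle_step_def Kh_def Sh_bc_def)
  note lims = Sh_tendsto_vertex[OF mesh \<Phi>(1)] Sh_tendsto_vertex[OF mesh \<Phi>(2)]
    Sh_tendsto_vertex[OF mesh W] Sh_tendsto_vertex[OF mesh previous(2)]
  have rh_lim: "((\<lambda>x. rh (\<Phi>0 x) (\<Phi>1 x)) \<longlongrightarrow> ?rh p) (at p within \<sigma>)"
    if "\<sigma> \<in> \<T>" "p \<in> vertices \<sigma>" for \<sigma> p
    using that unfolding rh_def rho_hat_def
    by (intro tendsto_add tendsto_of_continuous[OF cont(1)] tendsto_of_continuous[OF cont(2)] lims)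
  have heat: "\<theta> * Z + lam * (Q - uD * R) + \<tau> * ?X = 0"
  proof -
    let ?\<eta> = "\<lambda>x. W1 x - uD"
    have "?\<eta> \<in> Sh_bc \<Omega> \<T> dD 0"
      using solution Sh_diff[OF W Sh_const] by (auto simp: obstacle_step_def Sh_bc_def)
    then have "\<theta> * lumped \<T> (\<lambda>x. (W1 x - W0 x) / \<tau>) ?\<eta>
        + lam * lumped \<T> (\<lambda>x. rh (\<Phi>0 x) (\<Phi>1 x) * ((\<Phi>1 x - \<Phi>0 x) / \<tau>)) ?\<eta> + ?X = 0"
      using solution grad_diff_const[of W1 uD] by (auto simp: obstacle_step_def)
    moreover have "lumped \<T> (\<lambda>x. (W1 x - W0 x) / \<tau>) ?\<eta>
        = ?V (\<lambda>\<sigma> p. (1 / \<tau>) * ((W1 p - W0 p) * (W1 p - uD)))"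
      using params
      by (intro lumped_eq_vertex_sum[OF mesh, where F = "\<lambda>\<sigma> p. (W1 p - W0 p) / \<tau>" and
            H = "\<lambda>\<sigma> p. ?\<eta> p"] tendsto_divide tendsto_diff tendsto_const lims) auto
    moreover have "lumped \<T> (\<lambda>x. rh (\<Phi>0 x) (\<Phi>1 x) * ((\<Phi>1 x - \<Phi>0 x) / \<tau>)) ?\<eta>
        = ?V (\<lambda>\<sigma> p. (1 / \<tau>) * (?rh p * W1 p * ?D p - uD * (?rh p * ?D p)))"
      using params
      by (intro lumped_eq_vertex_sum[OF mesh, where F = "\<lambda>\<sigma> p. ?rh p * (?D p / \<tau>)" and
            H = "\<lambda>\<sigma> p. ?\<eta> p"] tendsto_mult tendsto_divide tendsto_diff tendsto_const lims rh_lim)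
        (auto simp: field_simps)
    ultimately have "\<theta> * (1 / \<tau> * Z) + lam * (1 / \<tau> * (Q - uD * R)) + ?X = 0"
      by (simp only: vertex_sum_cmult vertex_sum_diff Z_def Q_def R_def)
    then show ?thesis
      using params by (simp add: field_simps)
  qed
  have ineq: "\<epsilon> * (\<rho> / \<alpha>) * M + \<epsilon> * ?B \<le> c_Psi * (a / \<alpha>) * Q + inverse \<epsilon> * N"
  proof -
    have ring: "(A * q * w + i * f) * (f - g)
        = (-1) * (A * (q * w * (g - f)) + i * (f * (g - f)))"
      for A q w i f g :: real
      by (simp add: algebra_simps)
    let ?\<eta> = "\<lambda>x. \<Phi>0 x - \<Phi>1 x"
    have "\<epsilon> * (\<rho> / \<alpha>) * lumped \<T> (\<lambda>x. \<mu> (grad \<Phi>0 x) * ((\<Phi>1 x - \<Phi>0 x) / \<tau>)) ?\<eta>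
        + \<epsilon> * L2_inner \<Omega> (\<lambda>x. Br r L G (grad \<Phi>0 x) (grad \<Phi>1 x) *v grad \<Phi>1 x) (grad ?\<eta>)
        \<ge> lumped \<T> (\<lambda>x. c_Psi * (a / \<alpha>) * rh (\<Phi>0 x) (\<Phi>1 x) * W1 x + inverse \<epsilon> * \<Phi>0 x) ?\<eta>"
      using solution previous by (auto simp: obstacle_step_def)
    moreover have "lumped \<T> (\<lambda>x. \<mu> (grad \<Phi>0 x) * ((\<Phi>1 x - \<Phi>0 x) / \<tau>)) ?\<eta>
        = ?V (\<lambda>\<sigma> p. (-1) * (\<mu> (v0 \<sigma>) * (?D p)\<^sup>2 / \<tau>))"
    proof (rule lumped_eq_vertex_sum[OF mesh])
      fix \<sigma> p assume p: "\<sigma> \<in> \<T>" "p \<in> vertices \<sigma>"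
      have "((\<lambda>x. \<mu> (grad \<Phi>0 x)) \<longlongrightarrow> \<mu> (v0 \<sigma>)) (at p within \<sigma>)"
        by (rule tendsto_vertex_const) (simp only: grad_eqI[OF v0[OF p(1)]])
      then show "((\<lambda>x. \<mu> (grad \<Phi>0 x) * ((\<Phi>1 x - \<Phi>0 x) / \<tau>))
          \<longlongrightarrow> \<mu> (v0 \<sigma>) * (?D p / \<tau>)) (at p within \<sigma>)"
        using params by (intro tendsto_mult tendsto_divide tendsto_diff tendsto_const lims p) auto
      show "(?\<eta> \<longlongrightarrow> ?\<eta> p) (at p within \<sigma>)"
        by (intro tendsto_diff lims p)
      show "\<mu> (v0 \<sigma>) * (?D p / \<tau>) * ?\<eta> p = (-1) * (\<mu> (v0 \<sigma>) * (?D p)\<^sup>2 / \<tau>)"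
        using params by (simp add: field_simps power2_eq_square)
    qed
    moreover have "L2_inner \<Omega> (\<lambda>x. Br r L G (grad \<Phi>0 x) (grad \<Phi>1 x) *v grad \<Phi>1 x) (grad ?\<eta>)
        = (\<Sum>\<sigma>\<in>\<T>. measure lebesgue \<sigma> *
            - ((Br r L G (v0 \<sigma>) (v1 \<sigma>) *v v1 \<sigma>) \<bullet> (v1 \<sigma> - v0 \<sigma>)))"
    proof (rule L2_inner_elementwise_constant[OF mesh])
      fix \<sigma> x assume x: "\<sigma> \<in> \<T>" "x \<in> \<sigma>"
      have "GDERIV ?\<eta> x :> v0 \<sigma> - v1 \<sigma>"
        using v0[OF x] v1[OF x] by (rule GDERIV_diff)
      then have "grad ?\<eta> x = - (v1 \<sigma> - v0 \<sigma>)"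
        by (simp add: grad_eqI)
      then show "(Br r L G (grad \<Phi>0 x) (grad \<Phi>1 x) *v grad \<Phi>1 x) \<bullet> grad ?\<eta> x
          = - ((Br r L G (v0 \<sigma>) (v1 \<sigma>) *v v1 \<sigma>) \<bullet> (v1 \<sigma> - v0 \<sigma>))"
        by (simp only: grad_eqI[OF v0[OF x]] grad_eqI[OF v1[OF x]] inner_minus_right)
    qed
    moreover have "lumped \<T> (\<lambda>x. c_Psi * (a / \<alpha>) * rh (\<Phi>0 x) (\<Phi>1 x) * W1 x + inverse \<epsilon> * \<Phi>0 x) ?\<eta>
        = ?V (\<lambda>\<sigma> p. (-1) * ((c_Psi * (a / \<alpha>)) * (?rh p * W1 p * ?D p) + inverse \<epsilon> * (\<Phi>0 p * ?D p)))"
      by (intro lumped_eq_vertex_sum[OF mesh, where H = "\<lambda>\<sigma> p. ?\<eta> p" and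
            F = "\<lambda>\<sigma> p. c_Psi * (a / \<alpha>) * ?rh p * W1 p + inverse \<epsilon> * \<Phi>0 p"]
          tendsto_mult tendsto_add tendsto_diff tendsto_const lims rh_lim ring)
    ultimately have "\<epsilon> * (\<rho> / \<alpha>) * (-1 * M) + \<epsilon> * - ?B \<ge> -1 * (c_Psi * (a / \<alpha>) * Q + inverse \<epsilon> * N)"
      by (simp only: vertex_sum_cmult vertex_sum_add M_def Q_def N_def mult_minus_right sum_negf)
    then show ?thesis by simp
  qed
  have "?B \<ge> (\<Sum>\<sigma>\<in>\<T>. measure lebesgue \<sigma> * (1/2 * ((gam r L G (v1 \<sigma>))\<^sup>2 - (gam r L G (v0 \<sigma>))\<^sup>2)))"
    by (intro sum_mono mult_left_mono Br_energy_increment aniso) auto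
  also have "(\<Sum>\<sigma>\<in>\<T>. measure lebesgue \<sigma> * (1/2 * ((gam r L G (v1 \<sigma>))\<^sup>2 - (gam r L G (v0 \<sigma>))\<^sup>2)))
      = 1/2 * (?S v1 - ?S v0)"
    by (simp only: sum_distrib_left sum_subtractf[symmetric]) (simp add: algebra_simps)
  finally have grad_part: "1/2 * (?S v1 - ?S v0) \<le> ?B" .
  have "?V (\<lambda>\<sigma> p. 1/2 * (1 - (\<Phi>1 p)\<^sup>2) - 1/2 * (1 - (\<Phi>0 p)\<^sup>2)) \<le> ?V (\<lambda>\<sigma> p. (-1) * (\<Phi>0 p * ?D p))"
  proof (rule vertex_sum_mono)
    \<comment> \<open>The difference of the two sides is half the square of the increment.\<close>
    show "1/2 * (1 - (\<Phi>1 p)\<^sup>2) - 1/2 * (1 - (\<Phi>0 p)\<^sup>2) \<le> (-1) * (\<Phi>0 p * ?D p)" for p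
      using zero_le_power2[of "?D p"] by (simp add: power2_eq_square field_simps)
  qed
  then have pot_part: "?V (\<lambda>\<sigma> p. 1/2 * (1 - (\<Phi>1 p)\<^sup>2)) - ?V (\<lambda>\<sigma> p. 1/2 * (1 - (\<Phi>0 p)\<^sup>2)) \<le> - N"
    unfolding vertex_sum_diff vertex_sum_cmult[of _ "-1"] N_def by simp
  have "?V (\<lambda>\<sigma> p. 1/2 * (W1 p - uD)\<^sup>2 - 1/2 * (W0 p - uD)\<^sup>2) \<le> Z"
    unfolding Z_def
  proof (rule vertex_sum_mono)
    show "1/2 * (W1 p - uD)\<^sup>2 - 1/2 * (W0 p - uD)\<^sup>2 \<le> (W1 p - W0 p) * (W1 p - uD)" for p
      using zero_le_power2[of "W1 p - W0 p"] by (simp add: power2_eq_square field_simps)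
  qed
  then have temp_part: "1/2 * ?V (\<lambda>\<sigma> p. (W1 p - uD)\<^sup>2) - 1/2 * ?V (\<lambda>\<sigma> p. (W0 p - uD)\<^sup>2) \<le> Z"
    by (simp only: vertex_sum_diff vertex_sum_cmult)
  have M_eq: "\<tau> * (lam * \<rho> / a) * (\<epsilon> / c_Psi) * ?V (\<lambda>\<sigma> p. \<mu> (v0 \<sigma>) * (?D p / \<tau>)\<^sup>2)
      = k * (\<epsilon> * (\<rho> / \<alpha>) * M)"
  proof -
    have "(\<lambda>\<sigma> p. \<mu> (v0 \<sigma>) * (?D p / \<tau>)\<^sup>2) = (\<lambda>\<sigma> p. 1 / \<tau> * (\<mu> (v0 \<sigma>) * (?D p)\<^sup>2 / \<tau>))"
      using params by (simp add: fun_eq_iff power2_eq_square)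
    then have "?V (\<lambda>\<sigma> p. \<mu> (v0 \<sigma>) * (?D p / \<tau>)\<^sup>2) = 1 / \<tau> * M"
      by (simp only: vertex_sum_cmult M_def)
    then show ?thesis
      using params c_Psi_pos by (simp add: k_def)
  qed
  have "k * (\<epsilon> * (\<rho> / \<alpha>) * M + \<epsilon> * ?B) \<le> k * (c_Psi * (a / \<alpha>) * Q + inverse \<epsilon> * N)"
    using ineq k(1) by (intro mult_left_mono) auto
  also have "\<dots> = lam * Q + k * inverse \<epsilon> * N"
    by (simp only: k(2)[symmetric] ring_distribs mult.assoc)
  finally have 1: "k * (\<epsilon> * (\<rho> / \<alpha>) * M) + k * \<epsilon> * ?B \<le> lam * Q + k * inverse \<epsilon> * N"
    by (simp add: ring_distribs mult.assoc)
  have 2: "k * \<epsilon> * (1/2 * (?S v1 - ?S v0)) \<le> k * \<epsilon> * ?B"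
    using grad_part k params by (intro mult_left_mono) auto
  have 3: "k * inverse \<epsilon> * (?V (\<lambda>\<sigma> p. 1/2 * (1 - (\<Phi>1 p)\<^sup>2)) - ?V (\<lambda>\<sigma> p. 1/2 * (1 - (\<Phi>0 p)\<^sup>2)))
      \<le> k * inverse \<epsilon> * (- N)"
    using pot_part k params by (intro mult_left_mono) auto
  have 4: "\<theta> * (1/2 * ?V (\<lambda>\<sigma> p. (W1 p - uD)\<^sup>2) - 1/2 * ?V (\<lambda>\<sigma> p. (W0 p - uD)\<^sup>2)) \<le> \<theta> * Z"
    using temp_part params by (intro mult_left_mono) auto
  show ?thesis
    unfolding M_eq k_def[symmetric] R_def[symmetric]
    using 1 2 3 4 heat by (simp add: algebra_simps)
qed

theorem theorem3p6:
  fixes \<Omega> dN dD :: "(real^'d) set" and \<T> :: "(real^'d) set set" and dlast :: 'd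
    and \<epsilon> \<theta> lam \<rho> \<alpha> a Kp Km uD mubar r :: real and L n :: nat
    and G :: "nat \<Rightarrow> real^'d^'d" and \<beta> \<gamma> \<mu> :: "real^'d \<Rightarrow> real"
    and \<rho>s \<rho>p \<rho>m :: "real \<Rightarrow> real"
    and \<tau> :: "nat \<Rightarrow> real" and \<Phi> W :: "nat \<Rightarrow> real^'d \<Rightarrow> real"
  assumes dim: "CARD('d) = 2 \<or> CARD('d) = 3"
    and domain: "polyhedral_domain \<Omega>"
    and bdry: "frontier \<Omega> = closure dN \<union> closure dD" "dN \<inter> dD = {}"
    and bdry_cases: "frontier \<Omega> = dD \<or> frontier \<Omega> = dN \<or>
      (\<exists>H>0. \<Omega> = {x. \<forall>i. - H < x $ i \<and> x $ i < H} \<and>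
             dD = {x. (\<forall>i. i \<noteq> dlast \<longrightarrow> - H \<le> x $ i \<and> x $ i \<le> H) \<and> x $ dlast = H})"
    and uD_neumann: "frontier \<Omega> = dN \<Longrightarrow> uD = 0"
    and mesh: "simplicial_partition \<T> \<Omega>"
    and params: "\<epsilon> > 0" "\<theta> \<ge> 0" "lam > 0" "\<rho> \<ge> 0" "\<alpha> > 0" "a > 0" "Kp > 0" "Km > 0"
    and aniso: "r \<ge> 1" "L \<ge> 1" "\<And>l. l \<in> {1..L} \<Longrightarrow> sym_pos_def (G l)"
    and gamma: "\<gamma> = gam r L G"
    and beta: "\<And>p. \<beta> p \<ge> 0" "\<And>p. p \<noteq> 0 \<Longrightarrow> \<beta> p > 0" "\<And>c p. c > 0 \<Longrightarrow> \<beta> (c *\<^sub>R p) = c * \<beta> p"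
    and mubar: "\<exists>p1 p2. p1 \<noteq> 0 \<and> p2 \<noteq> 0 \<and>
      (\<forall>p. p \<noteq> 0 \<longrightarrow> \<gamma> p1 / \<beta> p1 \<le> \<gamma> p / \<beta> p \<and> \<gamma> p / \<beta> p \<le> \<gamma> p2 / \<beta> p2) \<and>
      \<gamma> p1 / \<beta> p1 \<le> mubar \<and> mubar \<le> \<gamma> p2 / \<beta> p2"
    and mu: "\<mu> = mu_fun \<gamma> \<beta> mubar"
    and shape: "\<rho>s C1_differentiable_on UNIV" "\<And>s. s \<in> {-1..1} \<Longrightarrow> \<rho>s s \<ge> 0"
      "(LBINT y=-1..1. \<rho>s y) = 1"
    and splitting: "\<And>s. \<rho>s s = \<rho>p s + \<rho>m s"
      "\<rho>p C1_differentiable_on UNIV" "\<rho>m C1_differentiable_on UNIV"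
    and step: "n \<ge> 1" "\<tau> n > 0"
    and previous: "\<Phi> (n - 1) \<in> Kh \<Omega> \<T>" "W (n - 1) \<in> Sh_bc \<Omega> \<T> dD uD"
    and solution: "obstacle_step \<Omega> \<T> dD \<epsilon> \<theta> lam \<rho> \<alpha> a uD (b_fun Kp Km) (rho_hat \<rho>p \<rho>m) \<mu> (Br r L G)
      (\<tau> n) (\<Phi> (n - 1)) (W (n - 1)) (\<Phi> n) (W n)"
  shows "Eh \<Omega> \<T> \<epsilon> \<theta> lam \<alpha> a uD \<gamma> (W n) (\<Phi> n)
      - ereal (uD * lam * lumped \<T> (\<lambda>x. rho_hat \<rho>p \<rho>m (\<Phi> (n - 1) x) (\<Phi> n x))
                                   (\<lambda>x. \<Phi> n x - \<Phi> (n - 1) x))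
      + ereal (\<tau> n * L2_inner \<Omega>
                 (\<lambda>x. nodal_interp \<Omega> \<T> (\<lambda>y. b_fun Kp Km (\<Phi> (n - 1) y)) x *\<^sub>R grad (W n) x)
                 (grad (W n)))
      + ereal (\<tau> n * (lam * \<rho> / a) * (\<epsilon> / c_Psi) *
                 (lumped_nrm \<T> (\<lambda>x. sqrt (\<mu> (grad (\<Phi> (n - 1)) x)) *
                                      ((\<Phi> n x - \<Phi> (n - 1) x) / \<tau> n)))\<^sup>2)
      \<le> Eh \<Omega> \<T> \<epsilon> \<theta> lam \<alpha> a uD \<gamma> (W (n - 1)) (\<Phi> (n - 1))
    \<and>
    ((\<forall>s\<in>{-1..1}. uD * deriv \<rho>p s \<le> 0 \<and> - uD * deriv \<rho>m s \<le> 0) \<longrightarrow>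
      Fh \<Omega> \<T> \<epsilon> \<theta> lam \<alpha> a uD \<rho>s \<gamma> (W n) (\<Phi> n)
      + ereal (\<tau> n * L2_inner \<Omega>
                 (\<lambda>x. nodal_interp \<Omega> \<T> (\<lambda>y. b_fun Kp Km (\<Phi> (n - 1) y)) x *\<^sub>R grad (W n) x)
                 (grad (W n)))
      + ereal (\<tau> n * (lam * \<rho> / a) * (\<epsilon> / c_Psi) *
                 (lumped_nrm \<T> (\<lambda>x. sqrt (\<mu> (grad (\<Phi> (n - 1)) x)) *
                                      ((\<Phi> n x - \<Phi> (n - 1) x) / \<tau> n)))\<^sup>2)
      \<le> Fh \<Omega> \<T> \<epsilon> \<theta> lam \<alpha> a uD \<rho>s \<gamma> (W (n - 1)) (\<Phi> (n - 1)))"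
proof -
  let ?\<Phi>0 = "\<Phi> (n - 1)" and ?\<Phi>1 = "\<Phi> n" and ?V = "vertex_sum \<T>"
  let ?D = "\<lambda>p. ?\<Phi>1 p - ?\<Phi>0 p" and ?rh = "\<lambda>p. rho_hat \<rho>p \<rho>m (?\<Phi>0 p) (?\<Phi>1 p)"
  have K1: "?\<Phi>1 \<in> Kh \<Omega> \<T>" and W1: "W n \<in> Sh \<Omega> \<T>" and W0: "W (n - 1) \<in> Sh \<Omega> \<T>"
    using solution previous by (auto simp: obstacle_step_def Sh_bc_def)
  have \<Phi>: "?\<Phi>0 \<in> Sh \<Omega> \<T>" "?\<Phi>1 \<in> Sh \<Omega> \<T>"
    using K1 previous by (auto simp: Kh_def)
  note lims = Sh_tendsto_vertex[OF mesh \<Phi>(1)] Sh_tendsto_vertex[OF mesh \<Phi>(2)]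
  note cont = C1_imp_continuous_on[OF splitting(2)] C1_imp_continuous_on[OF splitting(3)]
  note cont_s = C1_imp_continuous_on[OF shape(1)]
  obtain v0 where v0: "\<And>\<sigma> x. \<sigma> \<in> \<T> \<Longrightarrow> x \<in> \<sigma> \<Longrightarrow> GDERIV ?\<Phi>0 x :> v0 \<sigma>"
    using elementwise_gradient[OF mesh \<Phi>(1)] by blast
  obtain v1 where v1: "\<And>\<sigma> x. \<sigma> \<in> \<T> \<Longrightarrow> x \<in> \<sigma> \<Longrightarrow> GDERIV ?\<Phi>1 x :> v1 \<sigma>"
    using elementwise_gradient[OF mesh \<Phi>(2)] by blast
  define E0 where "E0 = \<theta> / 2 * ?V (\<lambda>\<sigma> p. (W (n - 1) p - uD)\<^sup>2)
      + lam * \<alpha> / (a * c_Psi) * (1/2 * \<epsilon> * (\<Sum>\<sigma>\<in>\<T>. measure lebesgue \<sigma> * (\<gamma> (v0 \<sigma>))\<^sup>2)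
        + inverse \<epsilon> * ?V (\<lambda>\<sigma> p. 1/2 * (1 - (?\<Phi>0 p)\<^sup>2)))"
  define E1 where "E1 = \<theta> / 2 * ?V (\<lambda>\<sigma> p. (W n p - uD)\<^sup>2)
      + lam * \<alpha> / (a * c_Psi) * (1/2 * \<epsilon> * (\<Sum>\<sigma>\<in>\<T>. measure lebesgue \<sigma> * (\<gamma> (v1 \<sigma>))\<^sup>2)
        + inverse \<epsilon> * ?V (\<lambda>\<sigma> p. 1/2 * (1 - (?\<Phi>1 p)\<^sup>2)))"
  define R where "R = ?V (\<lambda>\<sigma> p. ?rh p * ?D p)"
  define M where "M = ?V (\<lambda>\<sigma> p. \<mu> (v0 \<sigma>) * (?D p / \<tau> n)\<^sup>2)"
  define P where "P = (\<lambda>f. ?V (\<lambda>\<sigma> p. Pfun \<rho>s (f p)))"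
  define X where "X = L2_inner \<Omega>
    (\<lambda>x. nodal_interp \<Omega> \<T> (\<lambda>y. b_fun Kp Km (?\<Phi>0 y)) x *\<^sub>R grad (W n) x) (grad (W n))"
  have energy: "E1 - uD * lam * R + \<tau> n * X + \<tau> n * (lam * \<rho> / a) * (\<epsilon> / c_Psi) * M \<le> E0"
    using obstacle_step_energy_inequality[OF mesh params(1-3,5,6) step(2) aniso cont
        previous(1) W0 solution v0 v1]
    unfolding E0_def E1_def R_def M_def X_def gamma by simp

  have Eh0: "Eh \<Omega> \<T> \<epsilon> \<theta> lam \<alpha> a uD \<gamma> (W (n - 1)) ?\<Phi>0 = ereal E0"
    unfolding E0_def by (rule Eh_eq_real[OF mesh W0 previous(1)]) (rule grad_eqI[OF v0])
  have Eh1: "Eh \<Omega> \<T> \<epsilon> \<theta> lam \<alpha> a uD \<gamma> (W n) ?\<Phi>1 = ereal E1"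
    unfolding E1_def by (rule Eh_eq_real[OF mesh W1 K1]) (rule grad_eqI[OF v1])
  have R: "lumped \<T> (\<lambda>x. ?rh x) (\<lambda>x. ?D x) = R"
    unfolding R_def rho_hat_def
    by (intro lumped_eq_vertex_sum[OF mesh, where F = "\<lambda>\<sigma> p. \<rho>p (?\<Phi>1 p) + \<rho>m (?\<Phi>0 p)" and
          H = "\<lambda>\<sigma> p. ?D p"] tendsto_add tendsto_diff
        tendsto_of_continuous[OF cont(1)] tendsto_of_continuous[OF cont(2)] lims) auto
  have M: "(lumped_nrm \<T> (\<lambda>x. sqrt (\<mu> (grad ?\<Phi>0 x)) * (?D x / \<tau> n)))\<^sup>2 = M"
  proof -
    obtain p1 where "mubar \<ge> \<gamma> p1 / \<beta> p1"
      using mubar by blast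
    then have \<mu>_nonneg: "\<mu> q \<ge> 0" for q
      unfolding mu by (intro mu_fun_nonneg beta(1)) (simp_all add: gamma gam_nonneg)
    have "(lumped_nrm \<T> (\<lambda>x. sqrt (\<mu> (grad ?\<Phi>0 x)) * (?D x / \<tau> n)))\<^sup>2
        = ?V (\<lambda>\<sigma> p. (sqrt (\<mu> (v0 \<sigma>)) * (?D p / \<tau> n))\<^sup>2)"
    proof (rule lumped_nrm_square[OF mesh])
      fix \<sigma> p assume p: "\<sigma> \<in> \<T>" "p \<in> vertices \<sigma>"
      have "((\<lambda>x. sqrt (\<mu> (grad ?\<Phi>0 x))) \<longlongrightarrow> sqrt (\<mu> (v0 \<sigma>))) (at p within \<sigma>)"
        by (rule tendsto_vertex_const) (simp only: grad_eqI[OF v0[OF p(1)]])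
      then show "((\<lambda>x. sqrt (\<mu> (grad ?\<Phi>0 x)) * (?D x / \<tau> n))
          \<longlongrightarrow> sqrt (\<mu> (v0 \<sigma>)) * (?D p / \<tau> n)) (at p within \<sigma>)"
        using step(2)
        by (intro tendsto_mult tendsto_divide tendsto_diff tendsto_const lims p) auto
    qed
    then show ?thesis
      by (simp only: M_def power_mult_distrib real_sqrt_pow2[OF \<mu>_nonneg])
  qed
  have P: "lumped \<T> (\<lambda>x. Pfun \<rho>s (f x)) (\<lambda>x. 1) = P f" if "f \<in> Sh \<Omega> \<T>" for f
    unfolding P_def
  proof (rule lumped_eq_vertex_sum[OF mesh _ tendsto_const])
    fix \<sigma> p assume p: "\<sigma> \<in> \<T>" "p \<in> vertices \<sigma>"
    have "continuous_on UNIV (Pfun \<rho>s)"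
      using Pfun_has_real_derivative[OF cont_s]
      by (auto simp: continuous_on_eq_continuous_at intro: DERIV_isCont)
    then show "((\<lambda>x. Pfun \<rho>s (f x)) \<longlongrightarrow> Pfun \<rho>s (f p)) (at p within \<sigma>)"
      by (rule tendsto_of_continuous) (rule Sh_tendsto_vertex[OF mesh that p])
  qed simp

  have increment: "uD * R \<le> uD * (P ?\<Phi>1 - P ?\<Phi>0)"
    if sgn: "\<forall>s\<in>{-1..1}. uD * deriv \<rho>p s \<le> 0 \<and> - uD * deriv \<rho>m s \<le> 0"
  proof -
    have "?V (\<lambda>\<sigma> p. uD * (?rh p * ?D p)) \<le> ?V (\<lambda>\<sigma> p. uD * (Pfun \<rho>s (?\<Phi>1 p) - Pfun \<rho>s (?\<Phi>0 p)))"
    proof (rule vertex_sum_mono)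
      fix \<sigma> p assume p: "\<sigma> \<in> \<T>" "p \<in> vertices \<sigma>"
      show "uD * (?rh p * ?D p) \<le> uD * (Pfun \<rho>s (?\<Phi>1 p) - Pfun \<rho>s (?\<Phi>0 p))"
        using sgn Kh_vertex_bound[OF mesh previous(1) p] Kh_vertex_bound[OF mesh K1 p]
        by (intro rho_hat_increment[OF cont_s splitting]) auto
    qed
    then show ?thesis
      by (simp only: vertex_sum_cmult vertex_sum_diff R_def P_def)
  qed
  have mono: "lam * (uD * R) \<le> lam * (uD * (P ?\<Phi>1 - P ?\<Phi>0))"
    if "\<forall>s\<in>{-1..1}. uD * deriv \<rho>p s \<le> 0 \<and> - uD * deriv \<rho>m s \<le> 0"
    by (rule mult_left_mono[OF increment[OF that]]) (use params(3) in simp)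
  show ?thesis
  proof (intro conjI impI)
    assume sgn: "\<forall>s\<in>{-1..1}. uD * deriv \<rho>p s \<le> 0 \<and> - uD * deriv \<rho>m s \<le> 0"
    \<comment> \<open>\<open>mono\<close> replaces the discrete increment in the first assertion by that of the primitive.\<close>
    show "Fh \<Omega> \<T> \<epsilon> \<theta> lam \<alpha> a uD \<rho>s \<gamma> (W n) (\<Phi> n)
      + ereal (\<tau> n * L2_inner \<Omega>
                 (\<lambda>x. nodal_interp \<Omega> \<T> (\<lambda>y. b_fun Kp Km (\<Phi> (n - 1) y)) x *\<^sub>R grad (W n) x)
                 (grad (W n)))
      + ereal (\<tau> n * (lam * \<rho> / a) * (\<epsilon> / c_Psi) *
                 (lumped_nrm \<T> (\<lambda>x. sqrt (\<mu> (grad (\<Phi> (n - 1)) x)) *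
                                      ((\<Phi> n x - \<Phi> (n - 1) x) / \<tau> n)))\<^sup>2)
      \<le> Fh \<Omega> \<T> \<epsilon> \<theta> lam \<alpha> a uD \<rho>s \<gamma> (W (n - 1)) (\<Phi> (n - 1))"
      using mono[OF sgn] energy
      unfolding Fh_def Eh0 Eh1 M P[OF \<Phi>(1)] P[OF \<Phi>(2)] X_def[symmetric]
        ereal_minus plus_ereal.simps ereal_less_eq ring_distribs right_diff_distrib mult.assoc
        mult.left_commute[of lam uD]
      by linarith
  next
    show "Eh \<Omega> \<T> \<epsilon> \<theta> lam \<alpha> a uD \<gamma> (W n) (\<Phi> n)
      - ereal (uD * lam * lumped \<T> (\<lambda>x. rho_hat \<rho>p \<rho>m (\<Phi> (n - 1) x) (\<Phi> n x))
                                   (\<lambda>x. \<Phi> n x - \<Phi> (n - 1) x))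
      + ereal (\<tau> n * L2_inner \<Omega>
                 (\<lambda>x. nodal_interp \<Omega> \<T> (\<lambda>y. b_fun Kp Km (\<Phi> (n - 1) y)) x *\<^sub>R grad (W n) x)
                 (grad (W n)))
      + ereal (\<tau> n * (lam * \<rho> / a) * (\<epsilon> / c_Psi) *
                 (lumped_nrm \<T> (\<lambda>x. sqrt (\<mu> (grad (\<Phi> (n - 1)) x)) *
                                      ((\<Phi> n x - \<Phi> (n - 1) x) / \<tau> n)))\<^sup>2)
      \<le> Eh \<Omega> \<T> \<epsilon> \<theta> lam \<alpha> a uD \<gamma> (W (n - 1)) (\<Phi> (n - 1))"
      using energy
      unfolding Eh0 Eh1 R M X_def[symmetric] ereal_minus plus_ereal.simps ereal_less_eq .
  qed
qed

end
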